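(* Let $m\ge2$, $r\ge1$, let $\phi_1,\dots,\phi_r:\{0,\dots,m-1\}^2\to\mathbb{R}$, and let $\Phi:\Sigma_m^r\to\mathbb{R}$ be $\Phi(x^{(1)},\dots,x^{(r)})=\phi_1(x^{(1)}_1,x^{(1)}_2)\cdots\phi_r(x^{(r)}_1,x^{(r)}_2)$. For a Markov measure $\mu_{p,P}$ let $A(p,P)=\int_{\Sigma_m^r}\Phi\,d\mu_{p,P}^{\otimes r}$. Then $$A(p,P)=\prod_{k=1}^r\sum_{i,j=0}^{m-1}\phi_k(i,j)p_ip_{i,j},$$ and for any $\alpha$ with $E_\Phi(\alpha)\neq\emptyset$, $$h_{\rm top}(E_\Phi(\alpha))=\max_{A(p,P)=\alpha}H_2(p,P),$$ the maximum being over all couples $(p,P)$ with $A(p,P)=\alpha$.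
   Context: $\Sigma_m=\{0,\dots,m-1\}^{\mathbb{N}}$ with left shift $\sigma$; $x_1,x_2$ denote the first two coordinates of $x\in\Sigma_m$. A couple $(p,P)$ consists of a probability vector $p=(p_0,\dots,p_{m-1})$ and a stochastic matrix $P=(p_{i,j})$ with $pP=p$; $\mu_{p,P}$ is the associated shift-invariant Markov measure, $\mu_{p,P}([a_1\cdots a_n])=p_{a_1}p_{a_1,a_2}\cdots p_{a_{n-1},a_n}$, and $\mu_{p,P}^{\otimes r}$ its $r$-fold product. $H_2(p,P)=-\sum_{i=0}^{m-1}p_i\sum_{j=0}^{m-1}p_{i,j}\log p_{i,j}$ (with $0\log0=0$). $E_\Phi(\alpha)=\{x\in\Sigma_m:\lim_{n\to\infty}n^{-r}\sum_{1\le i_1,\dots,i_r\le n}\Phi(\sigma^{i_1}x,\dots,\sigma^{i_r}x)=\alpha\}$. $h_{\rm top}$ is Bowen's topological entropy of a set (defined via covers by Bowen balls $B_{n_i}(x_i,\epsilon)$ for the metrics $d_n(x,y)=\max_{0\le j<n}d(\sigma^jx,\sigma^jy)$, as the limit as $\epsilon\to0$ of the critical exponent $s$ of $\lim_n\inf\sum_ie^{-sn_i}$). *)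

theory Defs
  imports "HOL-Probability.Probability"
begin

text \<open>Full shift on m symbols: sequences indexed from 0 (paper: from 1).\<close>

definition Sigma_sh :: "nat \<Rightarrow> (nat \<Rightarrow> nat) set" where
  "Sigma_sh m = {x. \<forall>n. x n < m}"

definition shift :: "(nat \<Rightarrow> nat) \<Rightarrow> (nat \<Rightarrow> nat)" where
  "shift x = (\<lambda>n. x (Suc n))"

definition shift_dist :: "nat \<Rightarrow> (nat \<Rightarrow> nat) \<Rightarrow> (nat \<Rightarrow> nat) \<Rightarrow> real" where
  "shift_dist m x y = (if x = y then 0 else inverse (real m) ^ (LEAST n. x n \<noteq> y n))"

definition bowen_ball :: "nat \<Rightarrow> nat \<Rightarrow> (nat \<Rightarrow> nat) \<Rightarrow> real \<Rightarrow> (nat \<Rightarrow> nat) set" where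
  "bowen_ball m n x eps =
     {y \<in> Sigma_sh m. \<forall>j<n. shift_dist m ((shift ^^ j) x) ((shift ^^ j) y) < eps}"

text \<open>Bowen's topological entropy of a (not necessarily compact) set Z.
  Covers are countable families of Bowen balls, encoded as countable sets of
  (centre, length) pairs with lengths at least N.\<close>
definition bowen_M :: "nat \<Rightarrow> (nat \<Rightarrow> nat) set \<Rightarrow> real \<Rightarrow> real \<Rightarrow> nat \<Rightarrow> ennreal" where
  "bowen_M m Z s eps N =
     (INF C \<in> {C. countable C \<and> C \<subseteq> Sigma_sh m \<times> {N..} \<and>
                  Z \<subseteq> (\<Union>(x, n)\<in>C. bowen_ball m n x eps)}.
        \<integral>\<^sup>+ c. ennreal (exp (- s * real (snd c))) \<partial>count_space C)"

definition bowen_m :: "nat \<Rightarrow> (nat \<Rightarrow> nat) set \<Rightarrow> real \<Rightarrow> real \<Rightarrow> ennreal" where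
  "bowen_m m Z s eps = (SUP N. bowen_M m Z s eps N)"
  (* the limit as N \<rightarrow> \<infinity>; bowen_M is nondecreasing in N *)

definition bowen_h_eps :: "nat \<Rightarrow> (nat \<Rightarrow> nat) set \<Rightarrow> real \<Rightarrow> ereal" where
  "bowen_h_eps m Z eps = (INF s \<in> {s. bowen_m m Z s eps = 0}. ereal s)"

definition htop :: "nat \<Rightarrow> (nat \<Rightarrow> nat) set \<Rightarrow> ereal" where
  "htop m Z = (SUP eps \<in> {0<..}. bowen_h_eps m Z eps)"
  (* the limit as eps \<rightarrow> 0; bowen_h_eps is nonincreasing in eps *)

definition couple :: "nat \<Rightarrow> (nat \<Rightarrow> real) \<Rightarrow> (nat \<Rightarrow> nat \<Rightarrow> real) \<Rightarrow> bool" where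
  "couple m p P \<longleftrightarrow>
     (\<forall>i<m. p i \<ge> 0) \<and> (\<Sum>i<m. p i) = 1 \<and>
     (\<forall>i<m. \<forall>j<m. P i j \<ge> 0) \<and> (\<forall>i<m. (\<Sum>j<m. P i j) = 1) \<and>
     (\<forall>j<m. (\<Sum>i<m. p i * P i j) = p j)"

definition shift_space :: "nat \<Rightarrow> (nat \<Rightarrow> nat) measure" where
  "shift_space m = PiM UNIV (\<lambda>_. count_space {..<m})"

definition markov_measure :: "nat \<Rightarrow> (nat \<Rightarrow> real) \<Rightarrow> (nat \<Rightarrow> nat \<Rightarrow> real) \<Rightarrow> (nat \<Rightarrow> nat) measure" where
  "markov_measure m p P = (THE mu. sets mu = sets (shift_space m) \<and>
     (\<forall>n a. (\<forall>i\<le>n. a i < m) \<longrightarrow>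
        emeasure mu {x \<in> space (shift_space m). \<forall>i\<le>n. x i = a i} =
        ennreal (p (a 0) * (\<Prod>i<n. P (a i) (a (Suc i))))))"

definition Phi :: "(nat \<Rightarrow> nat \<Rightarrow> nat \<Rightarrow> real) \<Rightarrow> nat \<Rightarrow> (nat \<Rightarrow> nat \<Rightarrow> nat) \<Rightarrow> real" where
  "Phi phi r xs = (\<Prod>k<r. phi k (xs k 0) (xs k 1))"

definition A_int :: "nat \<Rightarrow> (nat \<Rightarrow> nat \<Rightarrow> nat \<Rightarrow> real) \<Rightarrow> nat \<Rightarrow> (nat \<Rightarrow> real) \<Rightarrow> (nat \<Rightarrow> nat \<Rightarrow> real) \<Rightarrow> real" where
  "A_int m phi r p P = integral\<^sup>L (PiM {..<r} (\<lambda>_. markov_measure m p P)) (Phi phi r)"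

definition H2 :: "nat \<Rightarrow> (nat \<Rightarrow> real) \<Rightarrow> (nat \<Rightarrow> nat \<Rightarrow> real) \<Rightarrow> real" where
  "H2 m p P = - (\<Sum>i<m. p i * (\<Sum>j<m. (if P i j = 0 then 0 else P i j * ln (P i j))))"

definition E_Phi :: "nat \<Rightarrow> (nat \<Rightarrow> nat \<Rightarrow> nat \<Rightarrow> real) \<Rightarrow> nat \<Rightarrow> real \<Rightarrow> (nat \<Rightarrow> nat) set" where
  "E_Phi m phi r alpha = {x \<in> Sigma_sh m.
     (\<lambda>n. (\<Sum>i\<in>PiE {..<r} (\<lambda>_. {1..n}). Phi phi r (\<lambda>k. (shift ^^ i k) x)) / real n ^ r)
       \<longlonglongrightarrow> alpha}"

end

theory Submission
  imports Defs
begin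

text \<open>
  The average in the definition of \<open>E_Phi\<close> is a product of \<open>r\<close> Birkhoff averages, hence a continuous
  function \<open>F\<close> of the empirical pair frequencies of \<open>x\<close>. These frequencies form a probability vector
  on pairs whose two marginals almost agree, and balanced vectors \<open>q\<close> are exactly the vectors
  \<open>p i * P i j\<close> of couples, with conditional entropy \<open>H2 m p P\<close>.

  Upper bound: at most \<open>m\<^sup>2 * exp (n * H q)\<close> words have type \<open>q\<close>, and there are only polynomially many
  types. Points of \<open>E_Phi\<close> eventually have types near the compact set of balanced \<open>q\<close> with
  \<open>F q = \<alpha>\<close>, so cylinders over words of such types give economical covers.

  Lower bound: no ergodic theorem is needed. The same count of types yields, for every balanced \<open>q\<close>, sets
  of about \<open>exp (n * H q)\<close> words with type close to \<open>q\<close>. Concatenating independent uniformly chosen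
  blocks of slowly growing length and increasing precision gives sequences whose pair frequencies all
  converge to \<open>q\<close>, and the mass distribution principle for the product measure on the blocks bounds
  the entropy from below.
\<close>

text \<open>The constraint is polynomial in \<open>q\<close> and not linear once
  \<open>r \<ge> 2\<close>, so the admissible set need not be convex. Compactness of
  \<open>pair_dists m\<close> and continuity of \<open>cond_entropy m\<close> therefore take the
  place of Legendre duality.

  An optimal couple may be reducible. Its Markov measure may then fail to be ergodic and can be
  carried by points outside \<open>E_Phi\<close>, so typical points of that measure are of no use
  for the lower bound; this is why points with the right frequencies are assembled from finite
  words.

  Scales are harmless: points at distance below 1 share their first letter, so a Bowen ball of
  radius 1 and length n fixes the first n letters, and a smaller radius costs a number of letters
  independent of n. Hence the lower bound works with \<open>eps = 1\<close> alone, and the upper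
  bound absorbs a constant factor.

  \<open>markov_measure\<close> is a definite description, so the formula for \<open>A_int\<close>
  presupposes existence and uniqueness of a measure with the prescribed cylinder values.\<close>

section \<open>Words and pair counts\<close>

text \<open>A word of parameter \<open>n\<close> has the \<open>n + 2\<close> letters \<open>a 0, \<dots>, a (n + 1)\<close>, but only the \<open>n\<close>
  transitions out of the positions \<open>1, \<dots>, n\<close> are counted: the averages defining \<open>E_Phi\<close> start at
  \<open>i = 1\<close> while sequences are indexed from \<open>0\<close>.\<close>

definition words :: "nat \<Rightarrow> nat \<Rightarrow> (nat \<Rightarrow> nat) set" where
  "words m n = PiE {..Suc n} (\<lambda>_. {..<m})"

definition pair_count :: "nat \<Rightarrow> (nat \<Rightarrow> nat) \<Rightarrow> nat \<Rightarrow> nat \<Rightarrow> nat" where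
  "pair_count n a i j = card {t \<in> {1..n}. a t = i \<and> a (Suc t) = j}"

definition path_weight :: "(nat \<Rightarrow> nat \<Rightarrow> real) \<Rightarrow> nat \<Rightarrow> (nat \<Rightarrow> nat) \<Rightarrow> real" where
  "path_weight P n a = (\<Prod>t\<in>{1..n}. P (a t) (a (Suc t)))"

lemma finite_words: "finite (words m n)"
  by (simp add: words_def finite_PiE)

lemma words_less: "a \<in> words m n \<Longrightarrow> t \<le> Suc n \<Longrightarrow> a t < m"
  by (auto simp: words_def)

lemma sum_eq_sum_pair_count:
  fixes f :: "nat \<Rightarrow> nat \<Rightarrow> real"
  assumes "\<And>t. t \<in> {1..Suc n} \<Longrightarrow> a t < m"
  shows "(\<Sum>t\<in>{1..n}. f (a t) (a (Suc t))) = (\<Sum>i<m. \<Sum>j<m. real (pair_count n a i j) * f i j)"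
proof -
  let ?g = "\<lambda>t. (a t, a (Suc t))"
  have "(\<Sum>t\<in>{1..n}. f (a t) (a (Suc t))) =
      (\<Sum>y\<in>{..<m} \<times> {..<m}. \<Sum>t | t \<in> {1..n} \<and> ?g t = y. f (a t) (a (Suc t)))"
    using assms by (intro sum.group[symmetric]) auto
  also have "\<dots> = (\<Sum>y\<in>{..<m} \<times> {..<m}. real (pair_count n a (fst y) (snd y)) * f (fst y) (snd y))"
  proof (intro sum.cong refl)
    fix y
    have "(\<Sum>t | t \<in> {1..n} \<and> ?g t = y. f (a t) (a (Suc t)))
        = (\<Sum>t | t \<in> {1..n} \<and> ?g t = y. f (fst y) (snd y))"
      by (intro sum.cong) auto
    also have "\<dots> = real (pair_count n a (fst y) (snd y)) * f (fst y) (snd y)"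
      by (auto simp: pair_count_def intro!: arg_cong[where f=card])
    finally show "(\<Sum>t | t \<in> {1..n} \<and> ?g t = y. f (a t) (a (Suc t)))
        = real (pair_count n a (fst y) (snd y)) * f (fst y) (snd y)" .
  qed
  finally show ?thesis by (simp add: sum.cartesian_product case_prod_unfold)
qed

lemma path_weight_eq_prod_pair_count:
  assumes "\<And>t. t \<in> {1..Suc n} \<Longrightarrow> a t < m"
  shows "path_weight P n a = (\<Prod>i<m. \<Prod>j<m. P i j ^ pair_count n a i j)"
proof -
  let ?g = "\<lambda>t. (a t, a (Suc t))"
  have "path_weight P n a =
      (\<Prod>y\<in>{..<m} \<times> {..<m}. \<Prod>t | t \<in> {1..n} \<and> ?g t = y. P (a t) (a (Suc t)))"
    unfolding path_weight_def using assms by (intro prod.group[symmetric]) auto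
  also have "\<dots> = (\<Prod>y\<in>{..<m} \<times> {..<m}. P (fst y) (snd y) ^ pair_count n a (fst y) (snd y))"
  proof (intro prod.cong refl)
    fix y
    have "(\<Prod>t | t \<in> {1..n} \<and> ?g t = y. P (a t) (a (Suc t)))
        = (\<Prod>t | t \<in> {1..n} \<and> ?g t = y. P (fst y) (snd y))"
      by (intro prod.cong) auto
    also have "\<dots> = P (fst y) (snd y) ^ pair_count n a (fst y) (snd y)"
      by (auto simp: pair_count_def intro!: arg_cong2[where f=power] arg_cong[where f=card])
    finally show "(\<Prod>t | t \<in> {1..n} \<and> ?g t = y. P (a t) (a (Suc t)))
        = P (fst y) (snd y) ^ pair_count n a (fst y) (snd y)" .
  qed
  finally show ?thesis by (simp add: prod.cartesian_product case_prod_unfold)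
qed

lemma sum_pair_count:
  assumes "\<And>t. t \<in> {1..Suc n} \<Longrightarrow> a t < m"
  shows "(\<Sum>i<m. \<Sum>j<m. real (pair_count n a i j)) = real n"
  using sum_eq_sum_pair_count[OF assms, where f="\<lambda>_ _. 1"] by simp

lemma pair_count_eq_0:
  assumes "\<And>t. t \<in> {1..Suc n} \<Longrightarrow> a t < m" "\<not> (i < m \<and> j < m)"
  shows "pair_count n a i j = 0"
proof -
  have "{t \<in> {1..n}. a t = i \<and> a (Suc t) = j} = {}"
    using assms(1)[of "_"] assms(1)[of "Suc _"] assms(2) by force
  then show ?thesis by (simp only: pair_count_def card.empty)
qed

text \<open>Row and column sums count the visits to i during the times 1 to n and 2 to n + 1. These
  windows differ only in their end points.\<close>

lemma pair_count_balance:
  assumes "\<And>t. t \<in> {1..Suc n} \<Longrightarrow> a t < m" "i < m"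
  shows "\<bar>(\<Sum>j<m. real (pair_count n a i j)) - (\<Sum>j<m. real (pair_count n a j i))\<bar> \<le> 1"
proof -
  let ?e = "\<lambda>t. if a t = i then 1 else (0::real)"
  have "(\<Sum>t\<in>{1..n}. ?e t) = (\<Sum>k<m. \<Sum>j<m. real (pair_count n a k j) * (if k = i then 1 else 0))"
    using sum_eq_sum_pair_count[OF assms(1), where f="\<lambda>k j. if k = i then 1 else 0"] by simp
  also have "\<dots> = (\<Sum>k<m. (if k = i then (\<Sum>j<m. real (pair_count n a k j)) else 0))"
    by (intro sum.cong) auto
  also have "\<dots> = (\<Sum>j<m. real (pair_count n a i j))"
    using assms(2) by (simp add: sum.delta)
  finally have r: "(\<Sum>t\<in>{1..n}. ?e t) = (\<Sum>j<m. real (pair_count n a i j))" .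
  have "(\<Sum>t\<in>{1..n}. ?e (Suc t)) = (\<Sum>k<m. \<Sum>j<m. real (pair_count n a k j) * (if j = i then 1 else 0))"
    using sum_eq_sum_pair_count[OF assms(1), where f="\<lambda>k j. if j = i then 1 else 0"] by simp
  also have "\<dots> = (\<Sum>k<m. real (pair_count n a k i))"
    using assms(2) by (simp add: sum.delta if_distrib cong: if_cong)
  finally have c: "(\<Sum>t\<in>{1..n}. ?e (Suc t)) = (\<Sum>k<m. real (pair_count n a k i))" .
  have "(\<Sum>t\<in>{1..n}. ?e (Suc t)) - (\<Sum>t\<in>{1..n}. ?e t) = ?e (Suc n) - ?e 1"
    by (induction n) auto
  then show ?thesis unfolding r c by (smt (verit))
qed

lemma words_Suc_bij:
  "bij_betw (\<lambda>(a, j). a(Suc (Suc n) := j)) (words m n \<times> {..<m}) (words m (Suc n))"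
proof -
  have eq: "words m (Suc n) = (\<lambda>(j, a). a(Suc (Suc n) := j)) ` ({..<m} \<times> words m n)"
    unfolding words_def atMost_Suc[of "Suc n"] by (rule PiE_insert_eq)
  have inj: "inj_on (\<lambda>(a, j). a(Suc (Suc n) := j)) (words m n \<times> {..<m})"
  proof (rule inj_onI, clarsimp)
    fix a j a' j' assume *: "a \<in> words m n" "a' \<in> words m n"
      "a(Suc (Suc n) := j) = a'(Suc (Suc n) := j')"
    have "a t = a' t" for t
    proof (cases "t = Suc (Suc n)")
      case True then show ?thesis using *(1,2) by (auto simp: words_def PiE_def extensional_def)
    next
      case False then show ?thesis using fun_cong[OF *(3), of t] by simp
    qed
    then show "a = a' \<and> j = j'" using fun_cong[OF *(3), of "Suc (Suc n)"] by auto
  qed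
  show ?thesis using inj unfolding bij_betw_def eq by force
qed

text \<open>Letters 0 and 1 are chosen freely without any weight, which accounts for the factor
  \<open>m ^ 2\<close>; summing out the last letter removes one stochastic factor.\<close>

lemma sum_path_weight:
  assumes "\<And>i. i < m \<Longrightarrow> (\<Sum>j<m. P i j) = 1"
  shows "(\<Sum>a\<in>words m n. path_weight P n a) = real m ^ 2"
proof (induction n)
  case 0
  show ?case by (simp add: path_weight_def words_def card_PiE power2_eq_square)
next
  case (Suc n)
  have "(\<Sum>a\<in>words m (Suc n). path_weight P (Suc n) a)
      = (\<Sum>y\<in>words m n \<times> {..<m}. path_weight P (Suc n) ((\<lambda>(a, j). a(Suc (Suc n) := j)) y))"
    by (rule sum.reindex_bij_betw[OF words_Suc_bij, symmetric])
  also have "\<dots> = (\<Sum>a\<in>words m n. \<Sum>j<m. path_weight P n a * P (a (Suc n)) j)"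
    unfolding sum.cartesian_product
  proof (intro sum.cong refl, clarsimp)
    fix a j
    have "(\<Prod>t = Suc 0..n. P ((a(Suc (Suc n) := j)) t) ((a(Suc (Suc n) := j)) (Suc t)))
        = (\<Prod>t = Suc 0..n. P (a t) (a (Suc t)))"
      by (intro prod.cong) auto
    then show "path_weight P (Suc n) (a(Suc (Suc n) := j)) = path_weight P n a * P (a (Suc n)) j"
      by (simp add: path_weight_def)
  qed
  also have "\<dots> = (\<Sum>a\<in>words m n. path_weight P n a)"
    by (intro sum.cong refl) (auto simp: sum_distrib_left[symmetric] assms words_less)
  finally show ?case using Suc by simp
qed

section \<open>Types and conditional entropy\<close>

text \<open>Vanishing outside the m by m square makes each distribution one function, so that having
  type \<open>q\<close> is an equation between functions and the set is compact in the product
  topology.\<close>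

definition pair_dists :: "nat \<Rightarrow> (nat \<Rightarrow> nat \<Rightarrow> real) set" where
  "pair_dists m = {q. (\<forall>i j. 0 \<le> q i j) \<and> (\<forall>i j. \<not> (i < m \<and> j < m) \<longrightarrow> q i j = 0) \<and>
     (\<Sum>i<m. \<Sum>j<m. q i j) = 1}"

definition pair_freq :: "nat \<Rightarrow> (nat \<Rightarrow> nat) \<Rightarrow> nat \<Rightarrow> nat \<Rightarrow> real" where
  "pair_freq n a i j = real (pair_count n a i j) / real n"

definition row_sum :: "nat \<Rightarrow> (nat \<Rightarrow> nat \<Rightarrow> real) \<Rightarrow> nat \<Rightarrow> real" where
  "row_sum m q i = (\<Sum>j<m. q i j)"

definition col_sum :: "nat \<Rightarrow> (nat \<Rightarrow> nat \<Rightarrow> real) \<Rightarrow> nat \<Rightarrow> real" where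
  "col_sum m q i = (\<Sum>j<m. q j i)"

definition imbalance :: "nat \<Rightarrow> (nat \<Rightarrow> nat \<Rightarrow> real) \<Rightarrow> real" where
  "imbalance m q = (\<Sum>i<m. \<bar>row_sum m q i - col_sum m q i\<bar>)"

definition x_ln_x :: "real \<Rightarrow> real" where
  "x_ln_x x = x * ln x"

text \<open>Shannon entropy of the pair minus that of its first letter. Writing it with
  \<open>x_ln_x\<close> instead of quotients gives continuity also where rows vanish.\<close>

definition cond_entropy :: "nat \<Rightarrow> (nat \<Rightarrow> nat \<Rightarrow> real) \<Rightarrow> real" where
  "cond_entropy m q = (\<Sum>i<m. x_ln_x (row_sum m q i) - (\<Sum>j<m. x_ln_x (q i j)))"

text \<open>States of mass zero get a uniform row, so that the matrix is always stochastic.\<close>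
definition cond_prob :: "nat \<Rightarrow> (nat \<Rightarrow> nat \<Rightarrow> real) \<Rightarrow> nat \<Rightarrow> nat \<Rightarrow> real" where
  "cond_prob m q i j = (if row_sum m q i = 0 then 1 / real m else q i j / row_sum m q i)"

text \<open>For positive \<open>P\<close> this is the relative entropy of the conditional laws of
  \<open>q\<close> with respect to the rows of \<open>P\<close>, averaged over the first letter. The
  form chosen is visibly continuous: an entropy plus a term linear in \<open>q\<close>.\<close>

definition cond_divergence :: "nat \<Rightarrow> (nat \<Rightarrow> nat \<Rightarrow> real) \<Rightarrow> (nat \<Rightarrow> nat \<Rightarrow> real) \<Rightarrow> real" where
  "cond_divergence m P q = - cond_entropy m q - (\<Sum>i<m. \<Sum>j<m. q i j * ln (P i j))"

section \<open>Pair distributions: elementary facts, compactness, continuity of the entropy\<close>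

lemma pair_distsD:
  assumes "q \<in> pair_dists m"
  shows "0 \<le> q i j" "\<not> (i < m \<and> j < m) \<Longrightarrow> q i j = 0" "(\<Sum>i<m. \<Sum>j<m. q i j) = 1"
  using assms by (auto simp: pair_dists_def)

lemma pair_dists_le_1:
  assumes "q \<in> pair_dists m"
  shows "q i j \<le> 1"
proof (cases "i < m \<and> j < m")
  case True
  then have "q i j \<le> (\<Sum>j<m. q i j)"
    by (intro member_le_sum pair_distsD(1)[OF assms]) auto
  also have "\<dots> \<le> (\<Sum>i<m. \<Sum>j<m. q i j)"
    using True by (intro member_le_sum[of i "{..<m}" "\<lambda>i. \<Sum>j<m. q i j"] sum_nonneg pair_distsD(1)[OF assms]) auto
  finally show ?thesis using pair_distsD(3)[OF assms] by simp
next
  case False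
  then show ?thesis using pair_distsD(2)[OF assms] by auto
qed

lemma row_sum_nonneg: "q \<in> pair_dists m \<Longrightarrow> 0 \<le> row_sum m q i"
  by (simp add: row_sum_def sum_nonneg pair_distsD(1))

lemma row_sum_eq_0D: "q \<in> pair_dists m \<Longrightarrow> row_sum m q i = 0 \<Longrightarrow> q i j = 0"
  by (cases "j < m") (auto simp: row_sum_def sum_nonneg_eq_0_iff pair_distsD)

lemma sum_row_sum: "q \<in> pair_dists m \<Longrightarrow> (\<Sum>i<m. row_sum m q i) = 1"
  by (simp add: row_sum_def pair_distsD)

text \<open>Tychonoff's theorem for function types; \<open>compact_pair_dists\<close> applies it
  once for each of the two arguments.\<close>

lemma compact_Collect_all_mem:
  fixes K :: "'a \<Rightarrow> ('b::topological_space) set"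
  assumes "\<And>i. compact (K i)"
  shows "compact {f. \<forall>i. f i \<in> K i}"
proof -
  have "compactin (product_topology (\<lambda>_. euclidean) UNIV) (PiE UNIV K)"
    using assms by (subst compactin_PiE) auto
  moreover have "PiE UNIV K = {f. \<forall>i. f i \<in> K i}" by auto
  ultimately show ?thesis by (simp add: euclidean_product_topology)
qed

lemma continuous_on_coord2: "continuous_on S (\<lambda>q::nat \<Rightarrow> nat \<Rightarrow> real. q i j)"
proof -
  have "continuous_on UNIV (\<lambda>q::nat \<Rightarrow> nat \<Rightarrow> real. q i)"
    by (rule continuous_on_product_coordinates)
  then have "continuous_on UNIV (\<lambda>q::nat \<Rightarrow> nat \<Rightarrow> real. q i j)"
    by (rule continuous_on_product_then_coordinatewise)
  then show ?thesis using continuous_on_subset by blast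
qed

lemma compact_pair_dists: "compact (pair_dists m)"
proof -
  let ?K = "\<lambda>i j. if i < m \<and> j < m then {0..1} else {0::real}"
  have c: "compact {q. \<forall>i. q i \<in> {f. \<forall>j. f j \<in> ?K i j}}"
    by (intro compact_Collect_all_mem) auto
  have cl: "closed {q::nat \<Rightarrow> nat \<Rightarrow> real. (\<Sum>i<m. \<Sum>j<m. q i j) = 1}"
    by (intro closed_Collect_eq continuous_intros continuous_on_coord2)
  have "pair_dists m = {q. \<forall>i. q i \<in> {f. \<forall>j. f j \<in> ?K i j}} \<inter> {q. (\<Sum>i<m. \<Sum>j<m. q i j) = 1}"
    (is "_ = ?R")
  proof
    show "pair_dists m \<subseteq> ?R" using pair_dists_le_1 by (auto simp: pair_dists_def)
    show "?R \<subseteq> pair_dists m"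
      by (auto simp: pair_dists_def split: if_splits) (metis atLeastAtMost_iff order_refl singletonD)+
  qed
  then show ?thesis using compact_Int_closed[OF c cl] by simp
qed

lemma continuous_on_x_ln_x: "continuous_on {0..} x_ln_x"
  unfolding continuous_on_def
proof -
  show "\<forall>x\<in>{0..}. (x_ln_x \<longlongrightarrow> x_ln_x x) (at x within {0..})"
  proof
    fix x :: real assume x: "x \<in> {0..}"
    show "(x_ln_x \<longlongrightarrow> x_ln_x x) (at x within {0..})"
    proof (cases "x = 0")
      case True
      have "((\<lambda>x::real. x * ln x) \<longlongrightarrow> 0) (at_right 0)" by real_asymp
      then show ?thesis using True by (simp add: x_ln_x_def[abs_def] at_within_Ici_at_right)
    next
      case False
      then show ?thesis using x unfolding x_ln_x_def[abs_def]
        by (intro tendsto_intros) auto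
    qed
  qed
qed

lemma continuous_on_x_ln_x_comp:
  assumes "continuous_on S f" "\<And>x. x \<in> S \<Longrightarrow> 0 \<le> f x"
  shows "continuous_on S (\<lambda>x. x_ln_x (f x))"
  using continuous_on_compose2[OF continuous_on_x_ln_x assms(1)] assms(2) by auto

lemma continuous_on_row_sum: "continuous_on S (\<lambda>q. row_sum m q i)"
  unfolding row_sum_def by (intro continuous_intros continuous_on_coord2)

lemma continuous_on_imbalance: "continuous_on S (imbalance m)"
  unfolding imbalance_def[abs_def] col_sum_def row_sum_def by (intro continuous_intros continuous_on_coord2)

lemma continuous_on_cond_entropy: "continuous_on (pair_dists m) (cond_entropy m)"
  unfolding cond_entropy_def[abs_def]
  by (intro continuous_intros continuous_on_x_ln_x_comp continuous_on_row_sum continuous_on_coord2)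
     (auto simp: row_sum_nonneg pair_distsD)

lemma continuous_on_cond_divergence: "continuous_on (pair_dists m) (cond_divergence m P)"
  unfolding cond_divergence_def[abs_def]
  by (intro continuous_intros continuous_on_cond_entropy continuous_on_coord2)

lemma x_ln_x_0 [simp]: "x_ln_x 0 = 0" by (simp add: x_ln_x_def)

lemma x_ln_x_mult: "0 \<le> x \<Longrightarrow> 0 \<le> y \<Longrightarrow> x_ln_x (x * y) = y * x_ln_x x + x * x_ln_x y"
  by (cases "x = 0 \<or> y = 0") (auto simp: x_ln_x_def ln_mult algebra_simps)

text \<open>The logarithm splits the quotient in \<open>cond_prob\<close>. Rows of mass zero
  contribute nothing to either side, so their default value is harmless.\<close>

lemma sum_ln_cond_prob:
  assumes "q \<in> pair_dists m"
  shows "(\<Sum>i<m. \<Sum>j<m. q i j * ln (cond_prob m q i j)) = - cond_entropy m q"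
proof -
  have "(\<Sum>j<m. q i j * ln (cond_prob m q i j)) = (\<Sum>j<m. x_ln_x (q i j)) - x_ln_x (row_sum m q i)" for i
  proof (cases "row_sum m q i = 0")
    case True then show ?thesis using row_sum_eq_0D[OF assms] by simp
  next
    case False
    then have r: "row_sum m q i > 0" using row_sum_nonneg[OF assms, of i] by simp
    have "q i j * ln (cond_prob m q i j) = x_ln_x (q i j) - q i j * ln (row_sum m q i)" for j
      using r pair_distsD(1)[OF assms, of i j]
      by (cases "q i j = 0") (auto simp: cond_prob_def x_ln_x_def ln_div algebra_simps)
    then have "(\<Sum>j<m. q i j * ln (cond_prob m q i j)) = (\<Sum>j<m. x_ln_x (q i j)) - (\<Sum>j<m. q i j) * ln (row_sum m q i)"
      by (simp add: sum_subtractf sum_distrib_right)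
    then show ?thesis by (simp add: x_ln_x_def row_sum_def)
  qed
  then show ?thesis by (simp add: cond_entropy_def sum_subtractf)
qed

lemma cond_prob_nonneg: "q \<in> pair_dists m \<Longrightarrow> 0 \<le> cond_prob m q i j"
  by (simp add: cond_prob_def pair_distsD row_sum_nonneg)

lemma sum_cond_prob:
  assumes "i < m" shows "(\<Sum>j<m. cond_prob m q i j) = 1"
  using assms by (cases "row_sum m q i = 0") (auto simp: cond_prob_def sum_divide_distrib[symmetric] row_sum_def)

lemma row_sum_mult_cond_prob:
  assumes "q \<in> pair_dists m" shows "row_sum m q i * cond_prob m q i j = q i j"
  using row_sum_eq_0D[OF assms, of i j] by (auto simp: cond_prob_def)

lemma couple_of_balanced:
  assumes "q \<in> pair_dists m" "imbalance m q = 0"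
  shows "couple m (row_sum m q) (cond_prob m q)"
proof -
  have b: "row_sum m q i = col_sum m q i" if "i < m" for i
    using assms(2) that by (auto simp: imbalance_def sum_nonneg_eq_0_iff)
  show ?thesis unfolding couple_def
    using assms(1) b[symmetric] by (auto simp: row_sum_nonneg sum_row_sum cond_prob_nonneg sum_cond_prob row_sum_mult_cond_prob col_sum_def)
qed

section \<open>Types of words and their number\<close>

lemma pair_freq_pair_dists:
  assumes "\<And>t. t \<in> {1..Suc n} \<Longrightarrow> a t < m" "n \<ge> 1"
  shows "pair_freq n a \<in> pair_dists m"
  using assms pair_count_eq_0[of n a m] sum_pair_count[of n a m]
  by (auto simp: pair_dists_def pair_freq_def sum_divide_distrib[symmetric])

lemma imbalance_pair_freq:
  assumes "\<And>t. t \<in> {1..Suc n} \<Longrightarrow> a t < m" "n \<ge> 1"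
  shows "imbalance m (pair_freq n a) \<le> real m / real n"
proof -
  have "\<bar>row_sum m (pair_freq n a) i - col_sum m (pair_freq n a) i\<bar> \<le> 1 / real n" if "i < m" for i
  proof -
    have "row_sum m (pair_freq n a) i - col_sum m (pair_freq n a) i = ((\<Sum>j<m. real (pair_count n a i j)) - (\<Sum>j<m. real (pair_count n a j i))) / real n"
      by (simp add: row_sum_def col_sum_def pair_freq_def sum_divide_distrib[symmetric] diff_divide_distrib)
    then show ?thesis using pair_count_balance[OF assms(1) that] assms(2) 
      by (simp add: divide_right_mono)
  qed
  then have "imbalance m (pair_freq n a) \<le> (\<Sum>i<m. 1 / real n)"
    unfolding imbalance_def by (intro sum_mono) auto
  then show ?thesis by simp
qed

text \<open>Positivity is asked only of transitions that occur, because \<open>cond_prob m q\<close>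
  may vanish elsewhere; there the exponent is 0 and both factors are 1.\<close>

lemma path_weight_eq_exp:
  assumes "\<And>t. t \<in> {1..Suc n} \<Longrightarrow> a t < m"
    and "\<And>i j. i < m \<Longrightarrow> j < m \<Longrightarrow> pair_count n a i j \<noteq> 0 \<Longrightarrow> P i j > 0"
    and "n \<ge> 1"
  shows "path_weight P n a = exp (real n * (\<Sum>i<m. \<Sum>j<m. pair_freq n a i j * ln (P i j)))"
proof -
  have "path_weight P n a = (\<Prod>i<m. \<Prod>j<m. exp (real (pair_count n a i j) * ln (P i j)))"
    unfolding path_weight_eq_prod_pair_count[of n a m, OF assms(1), simplified]
  proof (intro prod.cong refl)
    fix i j assume "i \<in> {..<m}" "j \<in> {..<m}"
    then show "P i j ^ pair_count n a i j = exp (real (pair_count n a i j) * ln (P i j))"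
      using assms(2)[of i j] by (cases "pair_count n a i j = 0") (auto simp: exp_of_nat_mult)
  qed
  then show ?thesis
    using assms(3) by (simp add: exp_sum pair_freq_def sum_distrib_left)
qed

text \<open>Under the chain with transition matrix \<open>cond_prob m q\<close> all words of type \<open>q\<close> have the same weight
  \<open>exp (- n * cond_entropy m q)\<close>, and the total weight of all words is \<open>m\<^sup>2\<close>.\<close>
lemma card_pair_freq_fibre:
  assumes "n \<ge> 1"
  shows "real (card {a \<in> words m n. pair_freq n a = q}) \<le> real m ^ 2 * exp (real n * cond_entropy m q)"
proof (cases "{a \<in> words m n. pair_freq n a = q} = {}")
  case True then show ?thesis unfolding True by simp
next
  case False
  let ?A = "{a \<in> words m n. pair_freq n a = q}"
  have lt: "a t < m" if "a \<in> words m n" "t \<in> {1..Suc n}" for a t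
    using words_less that by auto
  from False have q: "q \<in> pair_dists m"
    using pair_freq_pair_dists lt assms by blast
  have w: "path_weight (cond_prob m q) n a = exp (- real n * cond_entropy m q)" if "a \<in> ?A" for a
  proof -
    have "cond_prob m q i j > 0" if "pair_count n a i j \<noteq> 0" for i j
    proof -
      have "q i j \<noteq> 0" using \<open>a \<in> ?A\<close> that assms by (auto simp: pair_freq_def)
      then show ?thesis using cond_prob_nonneg[OF q, of i j] row_sum_mult_cond_prob[OF q, of i j]
        by (metis less_eq_real_def mult_zero_right)
    qed
    then have "path_weight (cond_prob m q) n a = exp (real n * (\<Sum>i<m. \<Sum>j<m. pair_freq n a i j * ln (cond_prob m q i j)))"
      using that lt assms by (intro path_weight_eq_exp) auto
    then show ?thesis using that sum_ln_cond_prob[OF q] by simp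
  qed
  have "real (card ?A) * exp (- real n * cond_entropy m q) = (\<Sum>a\<in>?A. path_weight (cond_prob m q) n a)"
    using w by simp
  also have "\<dots> \<le> (\<Sum>a\<in>words m n. path_weight (cond_prob m q) n a)"
    by (intro sum_mono2 finite_words) (auto simp: path_weight_def intro!: prod_nonneg cond_prob_nonneg q)
  also have "\<dots> = real m ^ 2" by (intro sum_path_weight sum_cond_prob)
  finally have "real (card ?A) * exp (- real n * cond_entropy m q) * exp (real n * cond_entropy m q) \<le> real m ^ 2 * exp (real n * cond_entropy m q)"
    by (intro mult_right_mono) auto
  then show ?thesis by (simp add: mult.assoc exp_add[symmetric])
qed

text \<open>A type is determined by \<open>m * m\<close> counts, each between 0 and n.\<close>

lemma card_pair_freq_image: "card (pair_freq n ` words m n) \<le> Suc n ^ (m * m)"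
proof -
  let ?S = "PiE ({..<m} \<times> {..<m}) (\<lambda>_. {..n})"
  let ?f = "\<lambda>g i j. if i < m \<and> j < m then real (g (i, j)) / real n else (0::real)"
  have "pair_freq n ` words m n \<subseteq> ?f ` ?S"
  proof
    fix q assume "q \<in> pair_freq n ` words m n"
    then obtain a where a: "a \<in> words m n" and q: "q = pair_freq n a" by auto
    let ?g = "restrict (\<lambda>(i, j). pair_count n a i j) ({..<m} \<times> {..<m})"
    have "card {t \<in> {1..n}. a t = i \<and> a (Suc t) = j} \<le> card {1..n}" for i j
      by (intro card_mono) auto
    then have "?g \<in> ?S" by (auto simp: pair_count_def)
    moreover have "q = ?f ?g"
      using a pair_count_eq_0[of n a m] by (auto simp: q pair_freq_def fun_eq_iff words_less)
    ultimately show "q \<in> ?f ` ?S" by blast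
  qed
  then have "card (pair_freq n ` words m n) \<le> card ?S"
    by (intro surj_card_le) (auto intro: finite_PiE)
  also have "\<dots> = Suc n ^ (m * m)" by (simp add: card_PiE card_cartesian_product)
  finally show ?thesis .
qed

text \<open>The method of types in the form both bounds need: with \<open>g\<close> constantly 1 it
  counts words, with \<open>g\<close> a path weight it bounds the mass of the words of unwanted
  type.\<close>

lemma sum_over_types:
  assumes "n \<ge> 1" "G \<subseteq> words m n" "\<And>a. a \<in> G \<Longrightarrow> 0 \<le> g (pair_freq n a)"
    and "\<And>a. a \<in> G \<Longrightarrow> exp (real n * cond_entropy m (pair_freq n a)) * g (pair_freq n a) \<le> b" "0 \<le> b"
  shows "(\<Sum>a\<in>G. g (pair_freq n a)) \<le> real (Suc n ^ (m * m)) * real m ^ 2 * b"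
proof -
  have fin: "finite G" using assms(2) finite_words finite_subset by blast
  have "(\<Sum>a\<in>G. g (pair_freq n a)) = (\<Sum>q\<in>pair_freq n ` G. \<Sum>a | a \<in> G \<and> pair_freq n a = q. g (pair_freq n a))"
    using fin by (intro sum.group[symmetric]) auto
  also have "\<dots> \<le> (\<Sum>q\<in>pair_freq n ` G. real m ^ 2 * b)"
  proof (intro sum_mono)
    fix q assume "q \<in> pair_freq n ` G"
    then have q: "0 \<le> g q" "exp (real n * cond_entropy m q) * g q \<le> b" using assms by auto
    have "(\<Sum>a | a \<in> G \<and> pair_freq n a = q. g (pair_freq n a)) = real (card {a \<in> G. pair_freq n a = q}) * g q"
      by simp
    also have "\<dots> \<le> real (card {a \<in> words m n. pair_freq n a = q}) * g q"
      using assms(2) q by (intro mult_right_mono of_nat_mono card_mono) (auto simp: finite_words)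
    also have "\<dots> \<le> real m ^ 2 * exp (real n * cond_entropy m q) * g q"
      using q by (intro mult_right_mono card_pair_freq_fibre assms)
    also have "\<dots> \<le> real m ^ 2 * b" using q by (simp add: mult.assoc mult_left_mono)
    finally show "(\<Sum>a | a \<in> G \<and> pair_freq n a = q. g (pair_freq n a)) \<le> real m ^ 2 * b" .
  qed
  also have "\<dots> = real (card (pair_freq n ` G)) * (real m ^ 2 * b)" by simp
  also have "\<dots> \<le> real (Suc n ^ (m * m)) * (real m ^ 2 * b)"
  proof (intro mult_right_mono of_nat_mono)
    have "card (pair_freq n ` G) \<le> card (pair_freq n ` words m n)"
      using assms(2) by (intro card_mono finite_imageI finite_words image_mono)
    then show "card (pair_freq n ` G) \<le> Suc n ^ (m * m)" using card_pair_freq_image order_trans by blast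
  qed (use assms in auto)
  finally show ?thesis by (simp add: mult.assoc)
qed

section \<open>Compactness arguments\<close>

definition l1_dist :: "nat \<Rightarrow> (nat \<Rightarrow> nat \<Rightarrow> real) \<Rightarrow> (nat \<Rightarrow> nat \<Rightarrow> real) \<Rightarrow> real" where
  "l1_dist m q q' = (\<Sum>i<m. \<Sum>j<m. \<bar>q i j - q' i j\<bar>)"

lemma continuous_on_l1_dist: "continuous_on S (\<lambda>q. l1_dist m q q')"
  unfolding l1_dist_def by (intro continuous_intros continuous_on_coord2)

text \<open>Gibbs' inequality for a single term, from \<open>ln t \<le> t - 1\<close> at
  \<open>t = y / x\<close>. Summed over two vectors of equal mass, the linear parts cancel.\<close>

lemma gibbs_term:
  fixes x y :: real
  assumes "0 \<le> x" "0 < y \<or> x = 0" "0 \<le> y"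
  shows "x - y \<le> x * ln (x / y)" "x * ln (x / y) = x - y \<Longrightarrow> x = y"
proof -
  have "x - y \<le> x * ln (x / y) \<and> (x * ln (x / y) = x - y \<longrightarrow> x = y)"
  proof (cases "x = 0")
    case True then show ?thesis using assms by auto
  next
    case False
    then have x: "x > 0" and y: "y > 0" using assms by auto
    have *: "ln (x / y) = - ln (y / x)" using x y by (simp add: ln_div)
    have "ln (y / x) \<le> y / x - 1" using x y by (intro ln_le_minus_one) auto
    then have "x * ln (y / x) \<le> x * (y / x - 1)" using x by (intro mult_left_mono) auto
    moreover have "x = y" if "x * ln (x / y) = x - y"
    proof -
      have "ln (y / x) = y / x - 1" using that x y unfolding * by (simp add: field_simps)
      then have "y / x = 1" using x y by (intro ln_eq_minus_one) auto
      then show ?thesis using x by simp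
    qed
    ultimately show ?thesis unfolding * using x by (simp add: algebra_simps)
  qed
  then show "x - y \<le> x * ln (x / y)" "x * ln (x / y) = x - y \<Longrightarrow> x = y" by auto
qed

text \<open>Gibbs' inequality compares \<open>q i j\<close> with
  \<open>row_sum m q i * P i j\<close>. Both have total mass 1, so the nonnegative terms
  \<open>D i j\<close> add up to exactly the divergence, and a zero sum forces each of them to
  vanish.\<close>

lemma
  assumes q: "q \<in> pair_dists m"
    and P: "\<And>i j. i < m \<Longrightarrow> j < m \<Longrightarrow> P i j > 0" "\<And>i. i < m \<Longrightarrow> (\<Sum>j<m. P i j) = 1"
  shows cond_divergence_nonneg: "0 \<le> cond_divergence m P q"
    and cond_divergence_eq_0D: "cond_divergence m P q = 0 \<Longrightarrow> i < m \<Longrightarrow> j < m \<Longrightarrow> q i j = row_sum m q i * P i j"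
proof -
  define D where "D i j = q i j * ln (q i j / (row_sum m q i * P i j)) - (q i j - row_sum m q i * P i j)" for i j
  have pos: "0 < row_sum m q i * P i j \<or> q i j = 0" if "i < m" "j < m" for i j
    using P(1)[OF that] row_sum_nonneg[OF q, of i] row_sum_eq_0D[OF q, of i j] by (cases "row_sum m q i = 0") auto
  have D: "0 \<le> D i j" "D i j = 0 \<Longrightarrow> q i j = row_sum m q i * P i j" if "i < m" "j < m" for i j
    using gibbs_term[OF pair_distsD(1)[OF q] pos[OF that]] P(1)[OF that] row_sum_nonneg[OF q, of i]
    by (auto simp: D_def)
  have "D i j = q i j * ln (cond_prob m q i j) - q i j * ln (P i j) - (q i j - row_sum m q i * P i j)"
    if "i < m" "j < m" for i j
    using pos[OF that] P(1)[OF that] row_sum_nonneg[OF q, of i] pair_distsD(1)[OF q, of i j]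
    by (cases "q i j = 0") (auto simp: D_def cond_prob_def ln_div ln_mult algebra_simps zero_less_mult_iff)
  then have "(\<Sum>i<m. \<Sum>j<m. D i j) = (\<Sum>i<m. \<Sum>j<m. q i j * ln (cond_prob m q i j) - q i j * ln (P i j) - (q i j - row_sum m q i * P i j))"
    by (intro sum.cong) auto
  also have "\<dots> = cond_divergence m P q - ((\<Sum>i<m. \<Sum>j<m. q i j) - (\<Sum>i<m. row_sum m q i * (\<Sum>j<m. P i j)))"
    by (simp add: sum_subtractf sum_ln_cond_prob[OF q] cond_divergence_def sum_distrib_left)
  also have "(\<Sum>i<m. row_sum m q i * (\<Sum>j<m. P i j)) = 1"
    using P(2) sum_row_sum[OF q] by simp
  finally have cond_divergence: "(\<Sum>i<m. \<Sum>j<m. D i j) = cond_divergence m P q" using pair_distsD(3)[OF q] by simp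
  have nn: "0 \<le> (\<Sum>j<m. D i j)" if "i < m" for i
    using D(1)[OF that] by (intro sum_nonneg) auto
  then show "0 \<le> cond_divergence m P q" unfolding cond_divergence[symmetric] by (intro sum_nonneg[of "{..<m}" "\<lambda>i. \<Sum>j<m. D i j"]) auto
  show "q i j = row_sum m q i * P i j" if "cond_divergence m P q = 0" "i < m" "j < m"
  proof -
    have "(\<Sum>i<m. \<Sum>j<m. D i j) = 0" using cond_divergence that(1) by simp
    then have "(\<Sum>j<m. D i j) = 0"
      using that(2) nn by (subst (asm) sum_nonneg_eq_0_iff) auto
    then have "D i j = 0"
      using that(3) D(1)[OF that(2)] by (subst (asm) sum_nonneg_eq_0_iff) auto
    then show ?thesis using D(2) that by auto
  qed
qed

text \<open>Subtract from \<open>p'\<close> the largest multiple of \<open>p\<close> that keeps the difference nonnegative: the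
  difference is stationary and vanishes at some state, hence everywhere.\<close>
lemma stationary_unique:
  fixes p p' :: "nat \<Rightarrow> real"
  assumes P: "\<And>i j. i < m \<Longrightarrow> j < m \<Longrightarrow> P i j > 0"
    and p: "\<And>i. i < m \<Longrightarrow> p i > 0" "(\<Sum>i<m. p i) = 1" "\<And>j. j < m \<Longrightarrow> (\<Sum>i<m. p i * P i j) = p j"
    and p': "(\<Sum>i<m. p' i) = 1" "\<And>j. j < m \<Longrightarrow> (\<Sum>i<m. p' i * P i j) = p' j"
    and "i < m"
  shows "p' i = p i"
proof -
  define c where "c = Min ((\<lambda>i. p' i / p i) ` {..<m})"
  have "c \<in> (\<lambda>i. p' i / p i) ` {..<m}" unfolding c_def using \<open>i < m\<close> by (intro Min_in) auto
  then obtain k where k: "k < m" "p' k = c * p k" using p(1) by (force simp: field_simps)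
  define v where "v i = p' i - c * p i" for i
  have v: "v i \<ge> 0" if "i < m" for i
  proof -
    have "c \<le> p' i / p i" unfolding c_def using that by (intro Min_le) auto
    then show ?thesis using p(1)[OF that] by (simp add: v_def field_simps)
  qed
  have "(\<Sum>i<m. v i * P i k) = (\<Sum>i<m. p' i * P i k) - c * (\<Sum>i<m. p i * P i k)"
    by (simp add: v_def algebra_simps sum_subtractf sum_distrib_left)
  also have "\<dots> = 0" using k p(3) p'(2) by simp
  finally have "\<forall>i\<in>{..<m}. v i * P i k = 0"
    using v P[THEN less_imp_le] k by (subst (asm) sum_nonneg_eq_0_iff) (auto intro!: mult_nonneg_nonneg)
  then have v0: "p' i = c * p i" if "i < m" for i
    using P[OF that k(1)] that by (auto simp: v_def)
  then have "(\<Sum>i<m. p' i) = c * (\<Sum>i<m. p i)" by (simp add: sum_distrib_left)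
  then have "c = 1" using p p' by simp
  then show ?thesis using v0 \<open>i < m\<close> by simp
qed

lemma compact_pos_lower_bound:
  fixes f :: "'a::topological_space \<Rightarrow> real"
  assumes "compact S" "continuous_on S f" "\<And>x. x \<in> S \<Longrightarrow> 0 < f x"
  shows "\<exists>c>0. \<forall>x\<in>S. c \<le> f x"
proof (cases "S = {}")
  case True then show ?thesis by (auto intro: exI[of _ 1])
next
  case False
  then obtain x where "x \<in> S" "\<forall>y\<in>S. f x \<le> f y"
    using continuous_attains_inf[OF assms(1) _ assms(2)] by auto
  then show ?thesis using assms(3) by blast
qed

lemma compact_superlevel:
  assumes "continuous_on (pair_dists m) f"
  shows "compact {q \<in> pair_dists m. (c::real) \<le> f q}"
proof -
  have "closed (pair_dists m \<inter> f -` {c..})"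
    by (intro continuous_closed_preimage assms compact_imp_closed compact_pair_dists closed_atLeast)
  then have "compact (pair_dists m \<inter> (pair_dists m \<inter> f -` {c..}))"
    by (intro compact_Int_closed compact_pair_dists)
  moreover have "pair_dists m \<inter> (pair_dists m \<inter> f -` {c..}) = {q \<in> pair_dists m. c \<le> f q}" by auto
  ultimately show ?thesis by simp
qed

lemma imbalance_nonneg: "0 \<le> imbalance m q"
  by (simp add: imbalance_def sum_nonneg)

text \<open>Empirical pair distributions are balanced only up to \<open>m / n\<close> and meet the constraint \<open>F q = \<alpha>\<close>
  only approximately; by compactness this costs little entropy.\<close>
lemma cond_entropy_bound_near:
  assumes F: "continuous_on (pair_dists m) F"
    and h: "\<And>q. q \<in> pair_dists m \<Longrightarrow> imbalance m q = 0 \<Longrightarrow> F q = (\<alpha>::real) \<Longrightarrow> cond_entropy m q \<le> h"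
    and "\<delta> > 0"
  shows "\<exists>\<eta>>0. \<forall>q\<in>pair_dists m. imbalance m q < \<eta> \<and> \<bar>F q - \<alpha>\<bar> < \<eta> \<longrightarrow> cond_entropy m q < h + \<delta>"
proof -
  let ?S = "{q \<in> pair_dists m. h + \<delta> \<le> cond_entropy m q}"
  \<comment> \<open>A zero of this sum in \<open>?S\<close> would be an admissible distribution with
    entropy at least \<open>h + \<delta>\<close>.\<close>
  have "\<exists>c>0. \<forall>q\<in>?S. c \<le> imbalance m q + \<bar>F q - \<alpha>\<bar>"
  proof (rule compact_pos_lower_bound)
    show "compact ?S" by (intro compact_superlevel continuous_on_cond_entropy)
    show "continuous_on ?S (\<lambda>q. imbalance m q + \<bar>F q - \<alpha>\<bar>)"
      by (intro continuous_intros continuous_on_imbalance continuous_on_subset[OF F]) auto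
    fix q assume "q \<in> ?S"
    then show "0 < imbalance m q + \<bar>F q - \<alpha>\<bar>"
      using h[of q] imbalance_nonneg[of m q] \<open>\<delta> > 0\<close> by fastforce
  qed
  then obtain c where c: "c > 0" "\<And>q. q \<in> ?S \<Longrightarrow> c \<le> imbalance m q + \<bar>F q - \<alpha>\<bar>" by auto
  show ?thesis
  proof (intro exI[of _ "c / 2"] conjI ballI impI)
    fix q assume "q \<in> pair_dists m" "imbalance m q < c / 2 \<and> \<bar>F q - \<alpha>\<bar> < c / 2"
    then show "cond_entropy m q < h + \<delta>" using c(2)[of q] by force
  qed (use c in simp)
qed

lemma balancedD: "imbalance m q = 0 \<Longrightarrow> i < m \<Longrightarrow> row_sum m q i = col_sum m q i"
  by (auto simp: imbalance_def sum_nonneg_eq_0_iff)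

text \<open>Where imbalance and divergence both vanish, \<open>q\<close> is balanced with transition
  matrix \<open>cond_prob m q0\<close>. That matrix is positive, so its stationary vector is unique
  and \<open>q\<close> equals \<open>q0\<close> on the square. Away from \<open>q0\<close>,
  compactness turns this into a positive rate of decay.\<close>

lemma cond_divergence_bound_far:
  assumes q0: "q0 \<in> pair_dists m" "imbalance m q0 = 0" "\<And>i j. i < m \<Longrightarrow> j < m \<Longrightarrow> q0 i j > 0"
    and "\<delta> > 0"
  shows "\<exists>c>0. \<forall>q\<in>pair_dists m. imbalance m q < c \<and> \<delta> \<le> l1_dist m q q0 \<longrightarrow> c \<le> cond_divergence m (cond_prob m q0) q"
proof -
  let ?P = "cond_prob m q0"
  have rpos: "row_sum m q0 i > 0" if "i < m" for i
    unfolding row_sum_def using that q0(3) by (intro sum_pos) auto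
  have P: "?P i j > 0" if "i < m" "j < m" for i j
    using rpos[OF that(1)] q0(3)[OF that] by (simp add: cond_prob_def)
  let ?S = "{q \<in> pair_dists m. \<delta> \<le> l1_dist m q q0}"
  have "\<exists>c>0. \<forall>q\<in>?S. c \<le> imbalance m q + cond_divergence m ?P q"
  proof (rule compact_pos_lower_bound)
    show "compact ?S" by (intro compact_superlevel continuous_on_l1_dist)
    show "continuous_on ?S (\<lambda>q. imbalance m q + cond_divergence m ?P q)"
      by (intro continuous_intros continuous_on_imbalance continuous_on_subset[OF continuous_on_cond_divergence]) auto
    fix q assume q: "q \<in> ?S"
    then have qp: "q \<in> pair_dists m" by simp
    have nn: "0 \<le> cond_divergence m ?P q" using cond_divergence_nonneg[OF qp P sum_cond_prob] by simp
    show "0 < imbalance m q + cond_divergence m ?P q"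
    proof (rule ccontr)
      assume "\<not> ?thesis"
      then have 0: "imbalance m q = 0" "cond_divergence m ?P q = 0" using nn imbalance_nonneg[of m q] by auto
      have eq: "q i j = row_sum m q i * ?P i j" if "i < m" "j < m" for i j
        using cond_divergence_eq_0D[OF qp P sum_cond_prob] 0 that by simp
      have "row_sum m q i = row_sum m q0 i" if "i < m" for i
      proof (rule stationary_unique[of m ?P])
        show "(\<Sum>i<m. row_sum m q0 i * ?P i j) = row_sum m q0 j" if "j < m" for j
          using balancedD[OF q0(2) that] by (simp add: row_sum_mult_cond_prob[OF q0(1)] col_sum_def)
        show "(\<Sum>i<m. row_sum m q i * ?P i j) = row_sum m q j" if "j < m" for j
          using balancedD[OF 0(1) that] eq[OF _ that] by (simp add: col_sum_def)
      qed (use that P rpos sum_row_sum[OF qp] sum_row_sum[OF q0(1)] in auto)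
      then have "q i j = q0 i j" if "i < m" "j < m" for i j
        using eq[OF that] row_sum_mult_cond_prob[OF q0(1), of i j] that by simp
      then have "l1_dist m q q0 = 0" by (simp add: l1_dist_def)
      then show False using q \<open>\<delta> > 0\<close> by simp
    qed
  qed
  then obtain c where c: "c > 0" "\<And>q. q \<in> ?S \<Longrightarrow> c \<le> imbalance m q + cond_divergence m ?P q" by auto
  show ?thesis
  proof (intro exI[of _ "c / 2"] conjI ballI impI)
    fix q assume "q \<in> pair_dists m" "imbalance m q < c / 2 \<and> \<delta> \<le> l1_dist m q q0"
    then show "c / 2 \<le> cond_divergence m ?P q" using c(2)[of q] by force
  qed (use c in simp)
qed

lemma poly_exp_tendsto_0:
  assumes "c > (0::real)"
  shows "(\<lambda>n. real (Suc n ^ d) * M * exp (- c * real n)) \<longlonglongrightarrow> 0"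
  using assms unfolding of_nat_power by real_asymp

text \<open>The two-letter marginal of the Markov measure. It forgets only the rows of states of
  mass zero, which affect neither \<open>H2\<close> nor \<open>A_int\<close>.\<close>

definition pair_law :: "nat \<Rightarrow> (nat \<Rightarrow> real) \<Rightarrow> (nat \<Rightarrow> nat \<Rightarrow> real) \<Rightarrow> nat \<Rightarrow> nat \<Rightarrow> real" where
  "pair_law m p P i j = (if i < m \<and> j < m then p i * P i j else 0)"

text \<open>The identity for \<open>H2\<close> is the chain rule for entropy: \<open>x_ln_x\<close>
  of a product splits into two terms, and the rows of \<open>P\<close> sum to 1.\<close>

lemma
  assumes "couple m p P"
  shows pair_law_in_pair_dists: "pair_law m p P \<in> pair_dists m"
    and imbalance_pair_law: "imbalance m (pair_law m p P) = 0"
    and H2_eq_cond_entropy: "H2 m p P = cond_entropy m (pair_law m p P)"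
proof -
  note cp = assms[unfolded couple_def]
  have r: "row_sum m (pair_law m p P) i = p i" if "i < m" for i
    using cp that by (simp add: row_sum_def pair_law_def sum_distrib_left[symmetric])
  have c: "col_sum m (pair_law m p P) i = p i" if "i < m" for i
    using cp that by (simp add: col_sum_def pair_law_def)
  show "pair_law m p P \<in> pair_dists m"
  proof -
    have "(\<Sum>i<m. \<Sum>j<m. pair_law m p P i j) = 1" using r cp by (simp add: row_sum_def[symmetric])
    then show ?thesis using cp by (auto simp: pair_dists_def) (auto simp: pair_law_def)
  qed
  show "imbalance m (pair_law m p P) = 0" using r c by (simp add: imbalance_def)
  have "- (p i * (\<Sum>j<m. if P i j = 0 then 0 else P i j * ln (P i j))) =
     x_ln_x (row_sum m (pair_law m p P) i) - (\<Sum>j<m. x_ln_x (pair_law m p P i j))" if "i < m" for i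
  proof -
    have "(\<Sum>j<m. x_ln_x (pair_law m p P i j)) = (\<Sum>j<m. P i j * x_ln_x (p i) + p i * x_ln_x (P i j))"
      using cp that by (intro sum.cong) (auto simp: pair_law_def x_ln_x_mult)
    also have "\<dots> = x_ln_x (p i) + p i * (\<Sum>j<m. x_ln_x (P i j))"
      using cp that by (simp add: sum.distrib sum_distrib_left[symmetric] sum_distrib_right[symmetric])
    also have "(\<Sum>j<m. x_ln_x (P i j)) = (\<Sum>j<m. if P i j = 0 then 0 else P i j * ln (P i j))"
      by (intro sum.cong) (auto simp: x_ln_x_def)
    finally show ?thesis using r[OF that] by simp
  qed
  then show "H2 m p P = cond_entropy m (pair_law m p P)" by (simp add: H2_def cond_entropy_def sum_negf[symmetric])
qed

section \<open>Words of a prescribed type\<close>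

lemma l1_dist_triangle: "l1_dist m q q'' \<le> l1_dist m q q' + l1_dist m q' q''"
  unfolding l1_dist_def sum.distrib[symmetric] by (intro sum_mono) auto

lemma abs_sum_le_l1_dist:
  "\<bar>(\<Sum>i<m. \<Sum>j<m. q i j * g i j) - (\<Sum>i<m. \<Sum>j<m. q' i j * g i j)\<bar>
     \<le> l1_dist m q q' * (\<Sum>i<m. \<Sum>j<m. \<bar>g i j\<bar>)"
proof -
  have "\<bar>g i j\<bar> \<le> (\<Sum>i<m. \<Sum>j<m. \<bar>g i j\<bar>)" if "i < m" "j < m" for i j
  proof -
    have "\<bar>g i j\<bar> \<le> (\<Sum>j<m. \<bar>g i j\<bar>)"
      using that by (intro member_le_sum) auto
    also have "\<dots> \<le> (\<Sum>i<m. \<Sum>j<m. \<bar>g i j\<bar>)"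
      using that by (intro member_le_sum[of i "{..<m}" "\<lambda>i. \<Sum>j<m. \<bar>g i j\<bar>"] sum_nonneg) auto
    finally show ?thesis .
  qed
  then have *: "\<bar>q i j - q' i j\<bar> * \<bar>g i j\<bar> \<le> \<bar>q i j - q' i j\<bar> * (\<Sum>i<m. \<Sum>j<m. \<bar>g i j\<bar>)"
    if "i < m" "j < m" for i j
    using that by (intro mult_left_mono) auto
  have "\<bar>(\<Sum>i<m. \<Sum>j<m. q i j * g i j) - (\<Sum>i<m. \<Sum>j<m. q' i j * g i j)\<bar>
      = \<bar>\<Sum>i<m. \<Sum>j<m. (q i j - q' i j) * g i j\<bar>"
    by (simp add: sum_subtractf algebra_simps)
  also have "\<dots> \<le> (\<Sum>i<m. \<Sum>j<m. \<bar>(q i j - q' i j) * g i j\<bar>)"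
    by (rule order_trans[OF sum_abs sum_mono[OF sum_abs]])
  also have "\<dots> \<le> (\<Sum>i<m. \<Sum>j<m. \<bar>q i j - q' i j\<bar> * (\<Sum>i<m. \<Sum>j<m. \<bar>g i j\<bar>))"
    using * by (intro sum_mono) (auto simp: abs_mult)
  finally show ?thesis by (simp add: l1_dist_def sum_distrib_right)
qed

text \<open>A mixture with the uniform distribution on pairs. The latter is balanced, so mixing
  preserves balance while charging every pair.\<close>

definition perturb :: "nat \<Rightarrow> (nat \<Rightarrow> nat \<Rightarrow> real) \<Rightarrow> real \<Rightarrow> nat \<Rightarrow> nat \<Rightarrow> real" where
  "perturb m q e i j = (if i < m \<and> j < m then (1 - e) * q i j + e / real m ^ 2 else 0)"

lemma
  assumes q: "q \<in> pair_dists m" and "0 < m"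
  shows perturb_in_pair_dists: "0 \<le> e \<Longrightarrow> e \<le> 1 \<Longrightarrow> perturb m q e \<in> pair_dists m"
    and imbalance_perturb: "imbalance m q = 0 \<Longrightarrow> imbalance m (perturb m q e) = 0"
    and perturb_pos: "0 < e \<Longrightarrow> e \<le> 1 \<Longrightarrow> i < m \<Longrightarrow> j < m \<Longrightarrow> 0 < perturb m q e i j"
    and perturb_0: "perturb m q 0 = q"
    and continuous_on_perturb: "continuous_on S (perturb m q)"
proof -
  note qD = pair_distsD[OF q]
  have r: "row_sum m (perturb m q e) i = (1 - e) * row_sum m q i + e / real m"
    and c: "col_sum m (perturb m q e) i = (1 - e) * col_sum m q i + e / real m" if "i < m" for i
    using that \<open>0 < m\<close>
    by (simp_all add: row_sum_def col_sum_def perturb_def sum.distrib sum_distrib_left power2_eq_square)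
  have "(\<Sum>i<m. row_sum m (perturb m q e) i) = (\<Sum>i<m. (1 - e) * row_sum m q i + e / real m)"
    using r by (intro sum.cong) auto
  also have "\<dots> = 1"
    using sum_row_sum[OF q] \<open>0 < m\<close> by (simp add: sum.distrib sum_distrib_left[symmetric])
  finally have s: "(\<Sum>i<m. \<Sum>j<m. perturb m q e i j) = 1" by (simp add: row_sum_def)
  show "perturb m q e \<in> pair_dists m" if "0 \<le> e" "e \<le> 1"
    using that s qD(1) unfolding pair_dists_def by (auto simp: perturb_def)
  show "imbalance m (perturb m q e) = 0" if "imbalance m q = 0"
    using balancedD[OF that] by (simp add: imbalance_def r c)
  show "0 < perturb m q e i j" if "0 < e" "e \<le> 1" "i < m" "j < m"
    using that qD(1)[of i j] \<open>0 < m\<close> unfolding perturb_def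
    by (auto intro!: add_nonneg_pos)
  show "perturb m q 0 = q" using qD(2) by (auto simp: perturb_def fun_eq_iff)
  show "continuous_on S (perturb m q)"
  proof (intro continuous_on_coordinatewise_then_product)
    fix i j show "continuous_on S (\<lambda>e. perturb m q e i j)"
      by (cases "i < m \<and> j < m") (auto simp: perturb_def intro!: continuous_intros)
  qed
qed

lemma exists_positive_approximation:
  assumes q: "q \<in> pair_dists m" "imbalance m q = 0" and "0 < m" and "\<delta> > 0"
  obtains q1 where "q1 \<in> pair_dists m" "imbalance m q1 = 0" "\<And>i j. i < m \<Longrightarrow> j < m \<Longrightarrow> 0 < q1 i j"
    "l1_dist m q1 q < \<delta>" "cond_entropy m q1 > cond_entropy m q - \<delta>"
proof -
  have cont: "continuous_on {0..1} (perturb m q)" by (rule continuous_on_perturb[OF q(1) \<open>0 < m\<close>])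
  have im: "perturb m q ` {0..1} \<subseteq> pair_dists m" using perturb_in_pair_dists[OF q(1) \<open>0 < m\<close>] by auto
  let ?f = "\<lambda>e. cond_entropy m (perturb m q e) - l1_dist m (perturb m q e) q"
  have "continuous_on {0..1} ?f"
    by (intro continuous_on_diff continuous_on_compose2[OF continuous_on_cond_entropy cont im]
        continuous_on_compose2[OF continuous_on_l1_dist[of UNIV] cont]) auto
  moreover have "continuous_on {0..1} (\<lambda>e. l1_dist m (perturb m q e) q)"
    by (intro continuous_on_compose2[OF continuous_on_l1_dist[of UNIV] cont]) auto
  \<comment> \<open>Continuity of the pair of functions yields one radius \<open>d\<close> for both
    estimates.\<close>
  ultimately have "continuous_on {0..1} (\<lambda>e. (cond_entropy m (perturb m q e), l1_dist m (perturb m q e) q))"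
    using continuous_on_compose2[OF continuous_on_cond_entropy cont im] by (intro continuous_on_Pair)
  then obtain d where d: "d > 0" "\<And>e. e \<in> {0..1} \<Longrightarrow> dist e 0 < d \<Longrightarrow>
      dist (cond_entropy m (perturb m q e), l1_dist m (perturb m q e) q) (cond_entropy m (perturb m q 0), l1_dist m (perturb m q 0) q) < \<delta>"
    unfolding continuous_on_iff using \<open>\<delta> > 0\<close> by (metis atLeastAtMost_iff order_refl zero_le_one)
  define e where "e = min 1 (d / 2)"
  have e: "0 < e" "e \<le> 1" "dist e 0 < d" using d(1) by (auto simp: e_def)
  then have D: "dist (cond_entropy m (perturb m q e), l1_dist m (perturb m q e) q) (cond_entropy m q, 0) < \<delta>"
    using d(2)[of e] by (simp add: perturb_0[OF q(1) \<open>0 < m\<close>] l1_dist_def)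
  show ?thesis
  proof (rule that[of "perturb m q e"])
    show "l1_dist m (perturb m q e) q < \<delta>" using dist_snd_le[of "(cond_entropy m (perturb m q e), l1_dist m (perturb m q e) q)" "(cond_entropy m q, 0)"] D
      by (simp add: dist_real_def)
    show "cond_entropy m (perturb m q e) > cond_entropy m q - \<delta>" using dist_fst_le[of "(cond_entropy m (perturb m q e), l1_dist m (perturb m q e) q)" "(cond_entropy m q, 0)"] D
      by (simp add: dist_real_def)
  qed (use e perturb_in_pair_dists[OF q(1) \<open>0 < m\<close>] imbalance_perturb[OF q(1) \<open>0 < m\<close> q(2)] perturb_pos[OF q(1) \<open>0 < m\<close>] in auto)
qed

text \<open>Sanov's bound for a positive chain near \<open>q\<close>: words of a type far from \<open>q1\<close> carry exponentially
  small weight, while each of the remaining words weighs at most about \<open>exp (- n * cond_entropy m q1)\<close>.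
  Perturbing \<open>q\<close> to a positive \<open>q1\<close> makes the argument work for reducible chains as well.\<close>
lemma many_words_of_type:
  assumes q: "q \<in> pair_dists m" "imbalance m q = 0" and "0 < m" and "\<delta> > 0"
  shows "\<exists>n\<ge>N. \<exists>W\<subseteq>words m n. (\<forall>a\<in>W. l1_dist m (pair_freq n a) q < \<delta>) \<and>
           exp (real n * (cond_entropy m q - \<delta>)) \<le> real (card W)"
proof -
  obtain q1 where q1: "q1 \<in> pair_dists m" "imbalance m q1 = 0" "\<And>i j. i < m \<Longrightarrow> j < m \<Longrightarrow> 0 < q1 i j"
    "l1_dist m q1 q < \<delta> / 2" "cond_entropy m q1 > cond_entropy m q - \<delta> / 2"
    using exists_positive_approximation[OF q \<open>0 < m\<close>, of "\<delta> / 2"] \<open>\<delta> > 0\<close> by auto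
  define P where "P = cond_prob m q1"
  have "row_sum m q1 i > 0" if "i < m" for i
    unfolding row_sum_def using that q1(3) by (intro sum_pos) auto
  then have P: "P i j > 0" if "i < m" "j < m" for i j
    using q1(3)[OF that] that by (simp add: cond_prob_def P_def)
  define C where "C = (\<Sum>i<m. \<Sum>j<m. \<bar>ln (P i j)\<bar>)"
  have C: "C \<ge> 0" by (simp add: C_def sum_nonneg)
  \<comment> \<open>The first bound serves the triangle inequality through \<open>q1\<close>. The
    second ensures that moving a type by \<open>\<delta>'\<close> changes its sum against
    \<open>ln (P i j)\<close> by at most \<open>\<delta> / 4\<close>.\<close>
  define \<delta>' where "\<delta>' = min (\<delta> / 2) (\<delta> / (4 * (C + 1)))"
  have \<delta>': "\<delta>' > 0" "\<delta>' \<le> \<delta> / 2" "\<delta>' * C \<le> \<delta> / 4"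
  proof -
    show "\<delta>' \<le> \<delta> / 2" unfolding \<delta>'_def by (rule min.cobounded1)
    show "\<delta>' > 0" using \<open>\<delta> > 0\<close> C by (auto simp: \<delta>'_def)
    have "\<delta>' * C \<le> \<delta> / (4 * (C + 1)) * (C + 1)"
      using C \<open>\<delta>' > 0\<close> by (intro mult_mono) (auto simp: \<delta>'_def)
    also have "\<dots> = \<delta> / 4" using C by (simp add: field_simps)
    finally show "\<delta>' * C \<le> \<delta> / 4" .
  qed
  obtain c where c: "c > 0" "\<And>q. q \<in> pair_dists m \<Longrightarrow> imbalance m q < c \<Longrightarrow> \<delta>' \<le> l1_dist m q q1 \<Longrightarrow> c \<le> cond_divergence m P q"
    using cond_divergence_bound_far[OF q1(1,2,3) \<delta>'(1)] unfolding P_def by blast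
  \<comment> \<open>For large n the far types weigh less than 1/2 in total, all types are balanced
    up to \<open>c\<close>, and the remaining weight, more than 1/2, exceeds
    \<open>exp (- (\<delta> / 4) * n)\<close>.\<close>
  have "\<forall>\<^sub>F n in sequentially. real (Suc n ^ (m * m)) * real m ^ 2 * exp (- c * real n) < 1 / 2"
    using order_tendstoD(2)[OF poly_exp_tendsto_0[OF c(1)], of "1/2"] by simp
  moreover have "\<forall>\<^sub>F n in sequentially. real m / real n < c"
    using c(1) by real_asymp
  moreover have "\<forall>\<^sub>F n in sequentially. exp (- (\<delta> / 4) * real n) < 1 / 2"
    using \<open>\<delta> > 0\<close> by real_asymp
  moreover have "\<forall>\<^sub>F n in sequentially. n \<ge> max 1 N" by (rule eventually_ge_at_top)
  ultimately have "\<forall>\<^sub>F n in sequentially. real (Suc n ^ (m * m)) * real m ^ 2 * exp (- c * real n) < 1 / 2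
      \<and> real m / real n < c \<and> exp (- (\<delta> / 4) * real n) < 1 / 2 \<and> n \<ge> max 1 N"
    by eventually_elim blast
  then obtain n where n: "real (Suc n ^ (m * m)) * real m ^ 2 * exp (- c * real n) < 1 / 2"
    "real m / real n < c" "exp (- (\<delta> / 4) * real n) < 1 / 2" "n \<ge> 1" "n \<ge> N"
    by (auto simp: eventually_sequentially)
  have lt: "a t < m" if "a \<in> words m n" "t \<in> {1..Suc n}" for a t
    using words_less that by auto
  have E: "pair_freq n a \<in> pair_dists m" "imbalance m (pair_freq n a) < c" if "a \<in> words m n" for a
    using pair_freq_pair_dists[of n a m] imbalance_pair_freq[of n a m] lt[OF that] n by auto
  define g where "g q = exp (real n * (\<Sum>i<m. \<Sum>j<m. q i j * ln (P i j)))" for q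
  have path_weight: "path_weight P n a = g (pair_freq n a)" if "a \<in> words m n" for a
    using path_weight_eq_exp[of n a m P] lt[OF that] P n(4)  pair_count_eq_0[of n a m] unfolding g_def by blast
  define W where "W = {a \<in> words m n. l1_dist m (pair_freq n a) q1 < \<delta>'}"
  let ?B = "{a \<in> words m n. \<not> l1_dist m (pair_freq n a) q1 < \<delta>'}"
  have W: "W \<subseteq> words m n" by (auto simp: W_def)
  have bad: "(\<Sum>a\<in>?B. g (pair_freq n a)) \<le> real (Suc n ^ (m * m)) * real m ^ 2 * exp (- c * real n)"
  proof (rule sum_over_types)
    fix a assume "a \<in> ?B"
    then have "c \<le> cond_divergence m P (pair_freq n a)" using c(2) E by auto
    then have "real n * c \<le> real n * cond_divergence m P (pair_freq n a)" by (rule mult_left_mono) auto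
    \<comment> \<open>The left side equals \<open>exp (- n * cond_divergence m P q)\<close> for the
      type \<open>q\<close> of the word.\<close>
    then show "exp (real n * cond_entropy m (pair_freq n a)) * g (pair_freq n a) \<le> exp (- c * real n)"
      by (simp add: g_def cond_divergence_def exp_add[symmetric] algebra_simps)
  qed (use n in \<open>auto simp: g_def\<close>)
  have "real m ^ 2 = (\<Sum>a\<in>words m n. path_weight P n a)"
    unfolding P_def by (intro sum_path_weight[symmetric] sum_cond_prob)
  also have "\<dots> = (\<Sum>a\<in>W. g (pair_freq n a)) + (\<Sum>a\<in>?B. g (pair_freq n a))"
    by (subst sum.union_disjoint[symmetric])
      (auto simp: W_def finite_words path_weight intro!: sum.cong)
  finally have "(\<Sum>a\<in>W. g (pair_freq n a)) > real m ^ 2 - 1 / 2" using bad n(1) by linarith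
  moreover have "real m ^ 2 \<ge> 1" using \<open>0 < m\<close> by simp
  ultimately have "exp (- (\<delta> / 4) * real n) \<le> (\<Sum>a\<in>W. g (pair_freq n a))" using n(3) by linarith
  also have "\<dots> \<le> (\<Sum>a\<in>W. exp (real n * (\<delta> / 4 - cond_entropy m q1)))"
  proof (intro sum_mono)
    fix a assume "a \<in> W"
    then have "l1_dist m (pair_freq n a) q1 * C \<le> \<delta>' * C"
      using C by (intro mult_right_mono) (auto simp: W_def)
    then have "(\<Sum>i<m. \<Sum>j<m. pair_freq n a i j * ln (P i j)) \<le> (\<Sum>i<m. \<Sum>j<m. q1 i j * ln (P i j)) + \<delta> / 4"
      using abs_sum_le_l1_dist[where m=m and q="pair_freq n a" and g="\<lambda>i j. ln (P i j)" and q'=q1] \<delta>'(3) by (simp add: C_def)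
    also have "(\<Sum>i<m. \<Sum>j<m. q1 i j * ln (P i j)) = - cond_entropy m q1"
      unfolding P_def by (rule sum_ln_cond_prob[OF q1(1)])
    finally show "g (pair_freq n a) \<le> exp (real n * (\<delta> / 4 - cond_entropy m q1))"
      by (simp add: g_def mult_left_mono)
  qed
  also have "\<dots> = real (card W) * exp (real n * (\<delta> / 4 - cond_entropy m q1))" by simp
  \<comment> \<open>The loss \<open>\<delta>\<close> is made up of \<open>\<delta> / 4\<close> for
    the total weight of \<open>W\<close>, \<open>\<delta> / 4\<close> for the variation of weights
    within \<open>W\<close>, and \<open>\<delta> / 2\<close> for the return from \<open>q1\<close>
    to \<open>q\<close>.\<close>
  finally have "exp (- (\<delta> / 4) * real n) * exp (- (real n * (\<delta> / 4 - cond_entropy m q1))) \<le> real (card W)"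
    by (simp add: exp_minus field_simps)
  then have "exp (real n * (cond_entropy m q1 - \<delta> / 2)) \<le> real (card W)"
    by (simp add: exp_add[symmetric] algebra_simps)
  moreover have "exp (real n * (cond_entropy m q - \<delta>)) \<le> exp (real n * (cond_entropy m q1 - \<delta> / 2))"
    using q1(5) by (simp add: mult_left_mono)
  moreover have "l1_dist m (pair_freq n a) q < \<delta>" if "a \<in> W" for a
    using that l1_dist_triangle[of m "pair_freq n a" q q1] q1(4) \<delta>'(2) by (auto simp: W_def)
  ultimately show ?thesis using n(5) W by (meson order_trans)
qed

section \<open>Markov measures\<close>

definition cylinder :: "nat \<Rightarrow> nat \<Rightarrow> (nat \<Rightarrow> nat) \<Rightarrow> (nat \<Rightarrow> nat) set" where
  "cylinder m n a = {x \<in> space (shift_space m). \<forall>i\<le>n. x i = a i}"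

lemma space_shift_space: "space (shift_space m) = Sigma_sh m"
  by (auto simp: shift_space_def space_PiM Sigma_sh_def PiE_def Pi_def)

lemma measurable_coord [measurable]: "(\<lambda>x. x i) \<in> measurable (shift_space m) (count_space {..<m})"
  unfolding shift_space_def by (rule measurable_component_singleton) simp

lemma measurable_coord_UNIV: "(\<lambda>x. x i) \<in> measurable (shift_space m) (count_space UNIV)"
  by (rule measurable_compose[OF measurable_coord, where g="\<lambda>x. x", simplified]) simp

lemma sets_cylinder [measurable]: "cylinder m n a \<in> sets (shift_space m)"
proof -
  note measurable_coord_UNIV[measurable]
  show ?thesis unfolding cylinder_def by measurable
qed

text \<open>Over a finite alphabet every event on finitely many coordinates is a finite disjoint
  union of cylinders, the only sets whose measure \<open>markov_measure\<close> prescribes.\<close>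

lemma emeasure_prod_emb_cylinders:
  assumes "sets \<mu> = sets (shift_space m)" "J \<subseteq> {..n}"
  shows "emeasure \<mu> (prod_emb UNIV (\<lambda>_. count_space {..<m}) J (PiE J A)) =
    (\<Sum>a\<in>{a \<in> PiE {..n} (\<lambda>_. {..<m}). \<forall>i\<in>J. a i \<in> A i}. emeasure \<mu> (cylinder m n a))"
    (is "_ = sum _ ?S")
proof -
  have fin: "finite ?S" by (simp add: finite_PiE)
  have "prod_emb UNIV (\<lambda>_. count_space {..<m}) J (PiE J A) = (\<Union>a\<in>?S. cylinder m n a)" (is "?L = ?R")
  proof
    show "?L \<subseteq> ?R"
    proof
      fix x assume x: "x \<in> ?L"
      then have sp: "x \<in> space (shift_space m)"
        by (auto simp: prod_emb_def shift_space_def space_PiM)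
      have "restrict x {..n} \<in> ?S"
        using x assms(2) by (auto simp: prod_emb_def PiE_def Pi_def)
      moreover have "x \<in> cylinder m n (restrict x {..n})"
        using sp by (auto simp: cylinder_def)
      ultimately show "x \<in> ?R" by blast
    qed
    show "?R \<subseteq> ?L"
    proof
      fix x assume "x \<in> ?R"
      then obtain a where a: "a \<in> ?S" "x \<in> cylinder m n a" by blast
      then have "x i \<in> A i" if "i \<in> J" for i
        using that assms(2) by (force simp: cylinder_def)
      then show "x \<in> ?L"
        using a by (auto simp: cylinder_def space_shift_space Sigma_sh_def prod_emb_def)
    qed
  qed
  also have "emeasure \<mu> (\<Union>a\<in>?S. cylinder m n a) = (\<Sum>a\<in>?S. emeasure \<mu> (cylinder m n a))"
  proof (rule sum_emeasure[symmetric])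
    show "cylinder m n ` ?S \<subseteq> sets \<mu>" using assms(1) by auto
    show "disjoint_family_on (cylinder m n) ?S"
      unfolding disjoint_family_on_def
    proof (intro ballI impI)
      fix a b assume ab: "a \<in> ?S" "b \<in> ?S" "a \<noteq> b"
      then obtain i where "a i \<noteq> b i" by blast
      moreover have "i \<le> n" using ab \<open>a i \<noteq> b i\<close> by (auto simp: PiE_def extensional_def)
      ultimately show "cylinder m n a \<inter> cylinder m n b = {}" by (auto simp: cylinder_def)
    qed
  qed (auto simp: finite_PiE)
  finally show ?thesis .
qed

lemma finite_measure_of_cylinders:
  assumes "sets \<mu> = sets (shift_space m)"
    and fin: "\<And>a. a 0 < m \<Longrightarrow> emeasure \<mu> (cylinder m 0 a) \<noteq> \<infinity>"
  shows "finite_measure \<mu>"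
proof
  have "space \<mu> = prod_emb UNIV (\<lambda>_. count_space {..<m}) {} (PiE {} (\<lambda>_. {}))"
    using sets_eq_imp_space_eq[OF assms(1)] by (auto simp: prod_emb_def shift_space_def space_PiM)
  then have "emeasure \<mu> (space \<mu>) = (\<Sum>a\<in>PiE {..0} (\<lambda>_. {..<m}). emeasure \<mu> (cylinder m 0 a))"
    using emeasure_prod_emb_cylinders[OF assms(1), of "{}" 0] by simp
  moreover have "emeasure \<mu> (cylinder m 0 a) \<noteq> top" if "a \<in> PiE {..0} (\<lambda>_. {..<m})" for a
  proof -
    have "a 0 < m" using PiE_mem[OF that, of 0] by simp
    then show ?thesis using fin[of a] by (simp only: infinity_ennreal_def not_False_eq_True)
  qed
  ultimately show "emeasure \<mu> (space \<mu>) \<noteq> \<infinity>" by (simp add: finite_PiE)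
qed

text \<open>The uniqueness required by the definite description. Finiteness, on which unique
  extension rests, is read off the cylinders of one letter.\<close>

lemma shift_space_measure_eqI:
  assumes "sets \<mu> = sets (shift_space m)" "sets \<nu> = sets (shift_space m)"
    and eq: "\<And>n a. (\<forall>i\<le>n. a i < m) \<Longrightarrow> emeasure \<mu> (cylinder m n a) = emeasure \<nu> (cylinder m n a)"
    and fin: "\<And>a. a 0 < m \<Longrightarrow> emeasure \<mu> (cylinder m 0 a) \<noteq> \<infinity>"
  shows "\<mu> = \<nu>"
proof (rule measure_eqI_PiM_infinite)
  let ?M = "\<lambda>_::nat. count_space {..<m}"
  show "sets \<mu> = sets (PiM UNIV ?M)" "sets \<nu> = sets (PiM UNIV ?M)"
    using assms(1,2) by (simp_all add: shift_space_def)
  show "emeasure \<mu> (prod_emb UNIV ?M J (PiE J A)) = emeasure \<nu> (prod_emb UNIV ?M J (PiE J A))"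
    if "finite J" for J A
  proof -
    have J: "J \<subseteq> {..Max (insert 0 J)}" using that by auto
    show ?thesis
      unfolding emeasure_prod_emb_cylinders[OF assms(1) J] emeasure_prod_emb_cylinders[OF assms(2) J]
      by (intro sum.cong refl eq) auto
  qed
  show "finite_measure \<mu>" by (rule finite_measure_of_cylinders[OF assms(1) fin])
qed

section \<open>Construction of the Markov chain from independent random maps\<close>

definition dist_pmf :: "nat \<Rightarrow> (nat \<Rightarrow> real) \<Rightarrow> nat pmf" where
  "dist_pmf m f = embed_pmf (\<lambda>j. if j < m then f j else 0)"

lemma pmf_dist_pmf:
  assumes "\<And>i. i < m \<Longrightarrow> 0 \<le> f i" "(\<Sum>i<m. f i) = 1"
  shows "pmf (dist_pmf m f) j = (if j < m then f j else 0)"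
  unfolding dist_pmf_def
proof (rule pmf_embed_pmf)
  have "(\<integral>\<^sup>+ x. ennreal (if x < m then f x else 0) \<partial>count_space UNIV) = (\<Sum>x<m. ennreal (if x < m then f x else 0))"
    by (rule nn_integral_count_space') auto
  also have "\<dots> = (\<Sum>x<m. ennreal (f x))" by (intro sum.cong) auto
  also have "\<dots> = ennreal (\<Sum>x<m. f x)" using assms by (intro sum_ennreal) auto
  also have "\<dots> = 1" using assms by simp
  finally show "(\<integral>\<^sup>+ x. ennreal (if x < m then f x else 0) \<partial>count_space UNIV) = 1" .
qed (use assms in auto)

text \<open>Samples of \<open>dist_pmf m f\<close> are below m only almost surely, whereas a map
  into \<open>shift_space m\<close> must take values in \<open>Sigma_sh m\<close> at every
  sample.\<close>

abbreviation clip :: "nat \<Rightarrow> nat \<Rightarrow> nat" where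
  "clip m v \<equiv> (if v < m then v else 0)"

lemma emeasure_dist_pmf_clip:
  assumes "\<And>i. i < m \<Longrightarrow> 0 \<le> f i" "(\<Sum>i<m. f i) = 1" "a < m"
  shows "emeasure (dist_pmf m f) {v. clip m v = a} = ennreal (f a)"
proof -
  have "set_pmf (dist_pmf m f) \<subseteq> {..<m}"
    by (auto simp: set_pmf_eq pmf_dist_pmf assms)
  then have "AE v in dist_pmf m f. v \<in> {v. clip m v = a} \<longleftrightarrow> v \<in> {a}"
    using assms(3) by (subst AE_measure_pmf_iff) auto
  then have "emeasure (dist_pmf m f) {v. clip m v = a} = emeasure (dist_pmf m f) {a}"
    by (intro emeasure_eq_AE) auto
  then show ?thesis using assms by (simp add: emeasure_pmf_single pmf_dist_pmf)
qed

text \<open>The chain driven by independent random self-maps \<open>w 1, w 2, \<dots>\<close> of the alphabet; \<open>w 0\<close> only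
  chooses the initial state.\<close>
primrec driven_chain :: "nat \<Rightarrow> (nat \<Rightarrow> nat \<Rightarrow> nat) \<Rightarrow> nat \<Rightarrow> nat" where
  "driven_chain m w 0 = clip m (w 0 0)"
| "driven_chain m w (Suc n) = clip m (w (Suc n) (driven_chain m w n))"

text \<open>Once the path is prescribed, the event splits into one condition on each map
  \<open>w k\<close> separately, so independence turns its probability into a product.\<close>

lemma driven_chain_eq_iff:
  "(\<forall>k\<le>n. driven_chain m w k = a k) \<longleftrightarrow>
   (\<forall>k\<le>n. clip m (w k (case k of 0 \<Rightarrow> 0 | Suc k \<Rightarrow> a k)) = a k)"
proof (induction n)
  case 0 then show ?case by simp
next
  case (Suc n)
  have split: "(\<forall>k\<le>Suc n. Q k) \<longleftrightarrow> (\<forall>k\<le>n. Q k) \<and> Q (Suc n)" for Q :: "nat \<Rightarrow> bool"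
    by (auto simp: le_Suc_eq)
  have "(\<forall>k\<le>Suc n. driven_chain m w k = a k) \<longleftrightarrow>
     (\<forall>k\<le>n. driven_chain m w k = a k) \<and> clip m (w (Suc n) (a n)) = a (Suc n)"
    unfolding split by (metis driven_chain.simps(2) order_refl)
  then show ?case unfolding Suc split by simp
qed

lemma markov_measure_exists:
  assumes "couple m p P" "0 < m"
  shows "\<exists>\<mu>. sets \<mu> = sets (shift_space m) \<and> (\<forall>n a. (\<forall>i\<le>n. a i < m) \<longrightarrow>
    emeasure \<mu> (cylinder m n a) = ennreal (p (a 0) * (\<Prod>i<n. P (a i) (a (Suc i)))))"
proof -
  note cp = assms(1)[unfolded couple_def]
  \<comment> \<open>The initial map is constant, so its evaluation at 0 has law \<open>p\<close>.
    Each later map draws an image of every state i from row i of \<open>P\<close>; only the law of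
    each single image matters.\<close>
  define K :: "nat \<Rightarrow> (nat \<Rightarrow> nat) pmf" where
    "K n = (if n = 0 then map_pmf (\<lambda>j _. j) (dist_pmf m p)
            else Pi_pmf {..<m} 0 (\<lambda>i. dist_pmf m (P i)))" for n
  let ?M = "\<lambda>n. measure_pmf (K n)"
  define \<Omega> where "\<Omega> = PiM UNIV ?M"
  interpret product_prob_space ?M UNIV ..
  have sp: "space \<Omega> = UNIV" by (auto simp: \<Omega>_def space_PiM)
  have w_meas: "(\<lambda>w. w k i) \<in> measurable \<Omega> (count_space UNIV)" for k i
  proof -
    have "(\<lambda>w. w k) \<in> measurable \<Omega> (?M k)" unfolding \<Omega>_def by (rule measurable_component_singleton) simp
    then show ?thesis by (rule measurable_compose) simp
  qed
  have X_meas: "(\<lambda>w. driven_chain m w k) \<in> measurable \<Omega> (count_space UNIV)" for k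
  proof (induction k)
    case 0
    show ?case using measurable_compose[OF w_meas, of "\<lambda>v. clip m v"] by simp
  next
    case (Suc k)
    have "(\<lambda>w. w (Suc k) (driven_chain m w k)) \<in> measurable \<Omega> (count_space UNIV)"
      by (rule measurable_compose_countable[OF w_meas Suc])
    from measurable_compose[OF this, of "\<lambda>v. clip m v"] show ?case by simp
  qed
  have "driven_chain m w k < m" for w k using \<open>0 < m\<close> by (cases k) auto
  then have X: "driven_chain m \<in> measurable \<Omega> (shift_space m)"
    unfolding shift_space_def
    using X_meas by (intro measurable_PiM_single') (auto simp: measurable_count_space_eq2 measurable_def)
  have "emeasure (distr \<Omega> (shift_space m) (driven_chain m)) (cylinder m n a) =
     ennreal (p (a 0) * (\<Prod>i<n. P (a i) (a (Suc i))))" if a: "\<forall>i\<le>n. a i < m" for n a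
  proof -
    define E where "E k = {f. clip m (f (case k of 0 \<Rightarrow> 0 | Suc k \<Rightarrow> a k)) = a k}" for k
    have "emeasure (distr \<Omega> (shift_space m) (driven_chain m)) (cylinder m n a)
       = emeasure \<Omega> (driven_chain m -` cylinder m n a \<inter> space \<Omega>)"
      by (intro emeasure_distr X sets_cylinder)
    also have "driven_chain m -` cylinder m n a \<inter> space \<Omega> = {w \<in> space \<Omega>. \<forall>k\<le>n. driven_chain m w k = a k}"
      using measurable_space[OF X] by (auto simp: cylinder_def)
    also have "\<dots> = {w \<in> space (PiM UNIV ?M). \<forall>k\<in>{..n}. w k \<in> E k}"
      unfolding driven_chain_eq_iff E_def \<Omega>_def by auto
    also have "emeasure \<Omega> \<dots> = (\<Prod>k\<in>{..n}. emeasure (?M k) (E k))"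
      unfolding \<Omega>_def by (rule emeasure_PiM_Collect) auto
    also have "\<dots> = emeasure (?M 0) (E 0) * (\<Prod>k<n. emeasure (?M (Suc k)) (E (Suc k)))"
      by (rule prod.atMost_shift)
    also have "emeasure (?M 0) (E 0) = ennreal (p (a 0))"
      using a cp emeasure_dist_pmf_clip[of m p "a 0"] by (simp add: K_def E_def vimage_def)
    also have "(\<Prod>k<n. emeasure (?M (Suc k)) (E (Suc k))) = (\<Prod>k<n. ennreal (P (a k) (a (Suc k))))"
    proof (intro prod.cong refl)
      fix k assume k: "k \<in> {..<n}"
      then have ak: "a k < m" "a (Suc k) < m" using a by auto
      have "emeasure (?M (Suc k)) (E (Suc k)) = emeasure (map_pmf (\<lambda>f. f (a k)) (K (Suc k))) {v. clip m v = a (Suc k)}"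
        by (simp add: E_def vimage_def)
      also have "map_pmf (\<lambda>f. f (a k)) (K (Suc k)) = dist_pmf m (P (a k))"
        using ak by (simp add: K_def Pi_pmf_component)
      finally show "emeasure (?M (Suc k)) (E (Suc k)) = ennreal (P (a k) (a (Suc k)))"
        using emeasure_dist_pmf_clip[of m "P (a k)" "a (Suc k)"] cp ak by simp
    qed
    also have "\<dots> = ennreal (\<Prod>k<n. P (a k) (a (Suc k)))"
      using cp a by (intro prod_ennreal) auto
    also have "ennreal (p (a 0)) * \<dots> = ennreal (p (a 0) * (\<Prod>i<n. P (a i) (a (Suc i))))"
      using cp a by (intro ennreal_mult[symmetric] prod_nonneg) auto
    finally show ?thesis .
  qed
  then show ?thesis by (intro exI[of _ "distr \<Omega> (shift_space m) (driven_chain m)"]) simp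
qed

section \<open>The measure selected by \<open>markov_measure\<close> and the integral of
  \<open>Phi\<close>\<close>

lemma
  assumes "couple m p P" "0 < m"
  shows sets_markov_measure: "sets (markov_measure m p P) = sets (shift_space m)"
    and emeasure_markov_cylinder: "(\<forall>i\<le>n. a i < m) \<Longrightarrow>
      emeasure (markov_measure m p P) (cylinder m n a) = ennreal (p (a 0) * (\<Prod>i<n. P (a i) (a (Suc i))))"
proof -
  let ?Q = "\<lambda>\<mu>. sets \<mu> = sets (shift_space m) \<and> (\<forall>n a. (\<forall>i\<le>n. a i < m) \<longrightarrow>
    emeasure \<mu> (cylinder m n a) = ennreal (p (a 0) * (\<Prod>i<n. P (a i) (a (Suc i)))))"
  have "\<exists>!\<mu>. ?Q \<mu>"
  proof (rule ex_ex1I)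
    show "\<exists>\<mu>. ?Q \<mu>" by (rule markov_measure_exists[OF assms])
    fix \<mu> \<nu> assume *: "?Q \<mu>" "?Q \<nu>"
    show "\<mu> = \<nu>"
    proof (rule shift_space_measure_eqI)
      fix a :: "nat \<Rightarrow> nat" assume "a 0 < m"
      then show "emeasure \<mu> (cylinder m 0 a) \<noteq> \<infinity>" using * by simp
    qed (use * in auto)
  qed
  from theI'[OF this] have Q: "?Q (markov_measure m p P)"
    unfolding markov_measure_def cylinder_def .
  show "sets (markov_measure m p P) = sets (shift_space m)" using Q by blast
  show "(\<forall>i\<le>n. a i < m) \<Longrightarrow>
      emeasure (markov_measure m p P) (cylinder m n a) = ennreal (p (a 0) * (\<Prod>i<n. P (a i) (a (Suc i))))"
    using Q by blast
qed

lemma finite_markov_measure: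
  assumes "couple m p P" "0 < m"
  shows "finite_measure (markov_measure m p P)"
proof (rule finite_measure_of_cylinders[OF sets_markov_measure[OF assms]])
  fix a :: "nat \<Rightarrow> nat" assume "a 0 < m"
  then show "emeasure (markov_measure m p P) (cylinder m 0 a) \<noteq> \<infinity>"
    using emeasure_markov_cylinder[OF assms, of 0 a] by simp
qed

text \<open>On the space a function of two letters is a finite combination of indicators of
  cylinders \<open>cylinder m 1\<close>, which fix coordinates 0 and 1 and have mass
  \<open>p i * P i j\<close>.\<close>

lemma
  fixes f :: "nat \<Rightarrow> nat \<Rightarrow> real"
  assumes "couple m p P" "0 < m"
  shows integrable_markov_pair: "integrable (markov_measure m p P) (\<lambda>x. f (x 0) (x 1))"
    and integral_markov_pair: "(\<integral>x. f (x 0) (x 1) \<partial>markov_measure m p P) = (\<Sum>i<m. \<Sum>j<m. f i j * p i * P i j)"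
proof -
  let ?\<mu> = "markov_measure m p P"
  interpret finite_measure ?\<mu> by (rule finite_markov_measure[OF assms])
  note cp = assms(1)[unfolded couple_def]
  note sets[measurable_cong] = sets_markov_measure[OF assms]
  define w where "w i j = (\<lambda>k::nat. if k = 0 then i else j)" for i j :: nat
  let ?g = "\<lambda>x. \<Sum>i<m. \<Sum>j<m. f i j * indicator (cylinder m 1 (w i j)) x"
  have eq: "f (x 0) (x 1) = ?g x" if "x \<in> space ?\<mu>" for x
  proof -
    have sp: "x \<in> space (shift_space m)" "x 0 < m" "x 1 < m"
      using that sets_eq_imp_space_eq[OF sets] by (auto simp: space_shift_space Sigma_sh_def)
    have "indicator (cylinder m 1 (w i j)) x = (if i = x 0 then if j = x 1 then 1 else 0 else (0::real))" for i j
      using sp(1) by (auto simp: cylinder_def w_def indicator_def le_Suc_eq)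
    then have "?g x = (\<Sum>i<m. \<Sum>j<m. if i = x 0 then if j = x 1 then f i j else 0 else 0)"
      by (intro sum.cong) auto
    also have "\<dots> = (\<Sum>i<m. if i = x 0 then (\<Sum>j<m. if j = x 1 then f i j else 0) else 0)"
      by (intro sum.cong) auto
    also have "\<dots> = f (x 0) (x 1)" using sp by simp
    finally show ?thesis by simp
  qed
  have int: "integrable ?\<mu> (\<lambda>x. f i j * indicator (cylinder m 1 (w i j)) x)" for i j
    by (intro integrable_mult_right integrable_real_indicator) (auto simp: less_top[symmetric])
  then have "integrable ?\<mu> ?g" by (intro Bochner_Integration.integrable_sum)
  then show "integrable ?\<mu> (\<lambda>x. f (x 0) (x 1))"
    using eq by (subst Bochner_Integration.integrable_cong[OF refl, of _ _ ?g]) auto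
  have "(\<integral>x. f (x 0) (x 1) \<partial>?\<mu>) = (\<integral>x. ?g x \<partial>?\<mu>)"
    by (rule Bochner_Integration.integral_cong[OF refl eq])
  also have "\<dots> = (\<Sum>i<m. \<Sum>j<m. f i j * measure ?\<mu> (cylinder m 1 (w i j)))"
  proof -
    have "(\<integral>x. ?g x \<partial>?\<mu>) = (\<Sum>i<m. \<integral>x. (\<Sum>j<m. f i j * indicator (cylinder m 1 (w i j)) x) \<partial>?\<mu>)"
      by (intro Bochner_Integration.integral_sum Bochner_Integration.integrable_sum int)
    also have "\<dots> = (\<Sum>i<m. \<Sum>j<m. \<integral>x. f i j * indicator (cylinder m 1 (w i j)) x \<partial>?\<mu>)"
      by (intro sum.cong refl Bochner_Integration.integral_sum int)
    also have "\<dots> = (\<Sum>i<m. \<Sum>j<m. f i j * measure ?\<mu> (cylinder m 1 (w i j)))"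
      by (intro sum.cong refl) (simp add: Int_absorb2 sets.sets_into_space sets)
    finally show ?thesis .
  qed
  also have "\<dots> = (\<Sum>i<m. \<Sum>j<m. f i j * p i * P i j)"
  proof (intro sum.cong refl)
    fix i j assume ij: "i \<in> {..<m}" "j \<in> {..<m}"
    have "emeasure ?\<mu> (cylinder m 1 (w i j)) = ennreal (p i * P i j)"
      using ij emeasure_markov_cylinder[OF assms, of 1 "w i j"] by (simp add: w_def)
    then show "f i j * measure ?\<mu> (cylinder m 1 (w i j)) = f i j * p i * P i j"
      using ij cp by (simp add: measure_def)
  qed
  finally show "(\<integral>x. f (x 0) (x 1) \<partial>?\<mu>) = (\<Sum>i<m. \<Sum>j<m. f i j * p i * P i j)" .
qed

lemma A_int_eq:
  assumes "couple m p P" "0 < m"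
  shows "A_int m phi r p P = (\<Prod>k<r. \<Sum>i<m. \<Sum>j<m. phi k i j * p i * P i j)"
proof -
  interpret finite_measure "markov_measure m p P" by (rule finite_markov_measure[OF assms])
  interpret product_sigma_finite "\<lambda>_::nat. markov_measure m p P" by standard
  have "A_int m phi r p P = (\<Prod>k<r. \<integral>x. phi k (x 0) (x 1) \<partial>markov_measure m p P)"
    unfolding A_int_def Phi_def[abs_def]
    by (rule product_integral_prod[OF finite_lessThan integrable_markov_pair[OF assms]])
  then show ?thesis unfolding integral_markov_pair[OF assms] .
qed

section \<open>The upper bound\<close>

text \<open>The common form of both sides of the constraint: its value at
  \<open>pair_freq n x\<close> is the average in \<open>E_Phi\<close>, its value at
  \<open>pair_law m p P\<close> is \<open>A_int m phi r p P\<close>.\<close>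

definition prod_average :: "nat \<Rightarrow> (nat \<Rightarrow> nat \<Rightarrow> nat \<Rightarrow> real) \<Rightarrow> nat \<Rightarrow> (nat \<Rightarrow> nat \<Rightarrow> real) \<Rightarrow> real" where
  "prod_average m phi r q = (\<Prod>k<r. \<Sum>i<m. \<Sum>j<m. q i j * phi k i j)"

lemma continuous_on_prod_average: "continuous_on S (prod_average m phi r)"
  unfolding prod_average_def[abs_def] by (intro continuous_intros continuous_on_coord2)

section \<open>Level sets through pair frequencies, and Bowen balls through cylinders\<close>

lemma funpow_shift: "(shift ^^ t) x = (\<lambda>n. x (t + n))"
  by (induction t arbitrary: x) (auto simp: shift_def fun_eq_iff)

lemma Sigma_shD: "x \<in> Sigma_sh m \<Longrightarrow> x n < m"
  by (simp add: Sigma_sh_def)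

text \<open>\<open>Phi\<close> is a product of functions of separate points, so distributivity turns
  the sum over r-tuples of times into a product of r sums over single times.\<close>

lemma E_Phi_iff:
  "x \<in> E_Phi m phi r \<alpha> \<longleftrightarrow> x \<in> Sigma_sh m \<and> (\<lambda>n. prod_average m phi r (pair_freq n x)) \<longlonglongrightarrow> \<alpha>"
proof -
  have "(\<Sum>i\<in>PiE {..<r} (\<lambda>_. {1..n}). Phi phi r (\<lambda>k. (shift ^^ i k) x)) / real n ^ r = prod_average m phi r (pair_freq n x)"
    if x: "x \<in> Sigma_sh m" for n
  proof -
    have "(\<Sum>i\<in>PiE {..<r} (\<lambda>_. {1..n}). Phi phi r (\<lambda>k. (shift ^^ i k) x)) =
        (\<Sum>i\<in>PiE {..<r} (\<lambda>_. {1..n}). \<Prod>k<r. phi k (x (i k)) (x (Suc (i k))))"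
      by (simp add: Phi_def funpow_shift)
    also have "\<dots> = (\<Prod>k<r. \<Sum>t\<in>{1..n}. phi k (x t) (x (Suc t)))"
      by (rule prod_sum_PiE[symmetric]) auto
    also have "\<dots> = (\<Prod>k<r. \<Sum>i<m. \<Sum>j<m. real (pair_count n x i j) * phi k i j)"
      using x by (intro prod.cong refl sum_eq_sum_pair_count) (auto simp: Sigma_shD)
    also have "\<dots> / real n ^ r = (\<Prod>k<r. (\<Sum>i<m. \<Sum>j<m. real (pair_count n x i j) * phi k i j) / real n)"
      by (simp add: prod_dividef)
    also have "\<dots> = prod_average m phi r (pair_freq n x)"
      unfolding prod_average_def pair_freq_def by (simp add: sum_divide_distrib)
    finally show ?thesis .
  qed
  then show ?thesis unfolding E_Phi_def by auto
qed

text \<open>After j < n shifts the points still agree on K letters. As \<open>K\<close> depends on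
  \<open>eps\<close> alone, covering by cylinders instead of balls changes weights by a constant
  factor.\<close>

lemma bowen_ball_contains:
  assumes "2 \<le> m" "inverse (real m) ^ K < eps" "y \<in> Sigma_sh m" "\<And>i. i < n + K \<Longrightarrow> x i = y i"
  shows "y \<in> bowen_ball m n x eps"
proof -
  have pos: "0 < inverse (real m)" "inverse (real m) \<le> 1" using assms(1) by (auto simp: field_simps)
  have "shift_dist m ((shift ^^ j) x) ((shift ^^ j) y) < eps" if j: "j < n" for j
  proof (cases "(shift ^^ j) x = (shift ^^ j) y")
    case True
    have "0 < inverse (real m) ^ K" using pos by simp
    then show ?thesis using True assms(2) by (simp add: shift_dist_def)
  next
    case False
    define L where "L = (LEAST i. (shift ^^ j) x i \<noteq> (shift ^^ j) y i)"
    obtain i where "(shift ^^ j) x i \<noteq> (shift ^^ j) y i" using False by (meson ext)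
    then have "(shift ^^ j) x L \<noteq> (shift ^^ j) y L" unfolding L_def by (rule LeastI)
    then have "x (j + L) \<noteq> y (j + L)" by (simp add: funpow_shift)
    then have "\<not> j + L < n + K" using assms(4) by blast
    then have "K \<le> L" using j by linarith
    then have "inverse (real m) ^ L \<le> inverse (real m) ^ K"
      using pos by (intro power_decreasing) auto
    then show ?thesis using False assms(2) by (simp add: shift_dist_def L_def)
  qed
  then show ?thesis using assms(3) by (simp add: bowen_ball_def)
qed

text \<open>Points with different first letters have distance exactly 1, so radius 1 already
  separates letters.\<close>

lemma bowen_ball_1D:
  assumes "y \<in> bowen_ball m n x 1" "j < n"
  shows "x j = y j"
proof (rule ccontr)
  assume ne: "x j \<noteq> y j"
  then have "(LEAST i. (shift ^^ j) x i \<noteq> (shift ^^ j) y i) = 0"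
    by (intro Least_equality) (auto simp: funpow_shift)
  moreover have "(shift ^^ j) x \<noteq> (shift ^^ j) y"
    using ne by (auto simp: funpow_shift fun_eq_iff intro: exI[of _ 0])
  ultimately have "shift_dist m ((shift ^^ j) x) ((shift ^^ j) y) = 1"
    by (simp add: shift_dist_def)
  then show False using assms by (auto simp: bowen_ball_def)
qed

lemma pair_freq_cong: "(\<And>t. t \<in> {1..Suc n} \<Longrightarrow> a t = b t) \<Longrightarrow> pair_freq n a = pair_freq n b"
  by (auto simp: pair_freq_def pair_count_def fun_eq_iff intro!: arg_cong[where f=card])

lemma nn_integral_count_space_UN_le:
  fixes f :: "'a \<Rightarrow> ennreal"
  shows "(\<integral>\<^sup>+c. f c \<partial>count_space (\<Union>k::nat. C k)) \<le> (\<Sum>k. \<integral>\<^sup>+c. f c \<partial>count_space (C k))"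
proof -
  have "(\<integral>\<^sup>+c. f c \<partial>count_space (\<Union>k. C k)) = (\<integral>\<^sup>+c. f c * indicator (\<Union>k. C k) c \<partial>count_space UNIV)"
    by (simp add: nn_integral_restrict_space[symmetric] restrict_count_space)
  also have "\<dots> \<le> (\<integral>\<^sup>+c. (\<Sum>k. f c * indicator (C k) c) \<partial>count_space UNIV)"
  proof (rule nn_integral_mono)
    fix c
    show "f c * indicator (\<Union>k. C k) c \<le> (\<Sum>k. f c * indicator (C k) c)"
    proof (cases "c \<in> (\<Union>k. C k)")
      case True
      then obtain k where "c \<in> C k" by auto
      then have "f c * indicator (\<Union>k. C k) c \<le> (\<Sum>k\<in>{k}. f c * indicator (C k) c)" using True by simp
      also have "\<dots> \<le> (\<Sum>k. f c * indicator (C k) c)" by (rule sum_le_suminf) auto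
      finally show ?thesis .
    qed simp
  qed
  also have "\<dots> = (\<Sum>k. \<integral>\<^sup>+c. f c * indicator (C k) c \<partial>count_space UNIV)"
    by (rule nn_integral_suminf) simp
  also have "\<dots> = (\<Sum>k. \<integral>\<^sup>+c. f c \<partial>count_space (C k))"
    by (simp add: nn_integral_restrict_space[symmetric] restrict_count_space)
  finally show ?thesis .
qed

lemma eventually_pair_freq_imbalance:
  assumes "x \<in> Sigma_sh m" "\<eta> > 0"
  shows "\<forall>\<^sub>F n in sequentially. pair_freq n x \<in> pair_dists m \<and> imbalance m (pair_freq n x) < \<eta>"
proof -
  have "\<forall>\<^sub>F n in sequentially. real m / real n < \<eta>" using assms(2) by real_asymp
  moreover have "\<forall>\<^sub>F n in sequentially. 1 \<le> n" by (rule eventually_ge_at_top)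
  ultimately show ?thesis
  proof eventually_elim
    case (elim n)
    then show ?case using pair_freq_pair_dists[of n x m] imbalance_pair_freq[of n x m] Sigma_shD[OF assms(1)] by force
  qed
qed

lemma htop_E_Phi_le:
  assumes "2 \<le> m"
    and h: "\<And>q. q \<in> pair_dists m \<Longrightarrow> imbalance m q = 0 \<Longrightarrow> prod_average m phi r q = \<alpha> \<Longrightarrow> cond_entropy m q \<le> h"
  shows "htop m (E_Phi m phi r \<alpha>) \<le> ereal h"
  unfolding htop_def
proof (rule SUP_least)
  fix eps :: real assume "eps \<in> {0<..}"
  then have eps: "0 < eps" by simp
  let ?E = "E_Phi m phi r \<alpha>"
  have zero: "bowen_m m ?E (h + 2 * \<delta>) eps = 0" if \<delta>: "\<delta> > 0" for \<delta>
  proof -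
    \<comment> \<open>One \<open>\<delta>\<close> pays for types that are only nearly admissible.
      Half of the other beats the polynomial number of types, and its second half leaves a geometric
      series.\<close>
    define s where "s = h + 2 * \<delta>"
    obtain \<eta> where \<eta>: "\<eta> > 0" "\<And>q. q \<in> pair_dists m \<Longrightarrow> imbalance m q < \<eta> \<Longrightarrow> \<bar>prod_average m phi r q - \<alpha>\<bar> < \<eta> \<Longrightarrow> cond_entropy m q < h + \<delta>"
      using cond_entropy_bound_near[OF continuous_on_prod_average h \<delta>] by blast
    obtain K where K: "inverse (real m) ^ K < eps"
      using real_arch_pow_inv[OF eps, of "inverse (real m)"] assms(1) by (auto simp: field_simps)
    define G where "G n = {a \<in> words m n. imbalance m (pair_freq n a) < \<eta> \<and> \<bar>prod_average m phi r (pair_freq n a) - \<alpha>\<bar> < \<eta>}" for n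
    have G: "G n \<subseteq> words m n" "finite (G n)" for n
      using finite_words[of m n] by (auto simp: G_def)
    have cardG: "real (card (G n)) \<le> real (Suc n ^ (m * m)) * real m ^ 2 * exp (real n * (h + \<delta>))" if "n \<ge> 1" for n
    proof -
      have "(\<Sum>a\<in>G n. (\<lambda>_. 1) (pair_freq n a)) \<le> real (Suc n ^ (m * m)) * real m ^ 2 * exp (real n * (h + \<delta>))"
      proof (rule sum_over_types[OF that G(1)])
        fix a assume a: "a \<in> G n"
        then have "pair_freq n a \<in> pair_dists m"
          using pair_freq_pair_dists[of n a m] that words_less[of a m n] by (auto simp: G_def)
        then have "cond_entropy m (pair_freq n a) < h + \<delta>" using a \<eta>(2) by (auto simp: G_def)
        then show "exp (real n * cond_entropy m (pair_freq n a)) * 1 \<le> exp (real n * (h + \<delta>))"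
          by (simp add: mult_left_mono)
      qed auto
      then show ?thesis by simp
    qed
    \<comment> \<open>A word of parameter n has n + 2 letters, so its cylinder lies in a ball of
      length \<open>n + 2 - K\<close>. The exponential is the resulting correction to
      \<open>exp (- s * n)\<close>.\<close>
    define M where "M = real m ^ 2 * exp (s * (real K - 2))"
    have "\<forall>\<^sub>F n in sequentially. real (Suc n ^ (m * m)) * M * exp (- (\<delta> / 2) * real n) < 1"
      using order_tendstoD(2)[OF poly_exp_tendsto_0[of "\<delta> / 2"], of 1] \<delta> by simp
    then obtain n1 where n1: "\<And>n. n \<ge> n1 \<Longrightarrow> real (Suc n ^ (m * m)) * M * exp (- (\<delta> / 2) * real n) < 1"
      by (auto simp: eventually_sequentially)
    define \<rho> where "\<rho> = exp (- (\<delta> / 2))"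
    have \<rho>: "0 < \<rho>" "\<rho> < 1" using \<delta> by (auto simp: \<rho>_def)
    have weight: "real (card (G n)) * exp (- s * real (n + 2 - K)) \<le> \<rho> ^ n" if n: "n \<ge> n1" "n \<ge> K" "n \<ge> 1" for n
    proof -
      have cancel: "A * exp X * (B * E * E * exp (- X)) = A * B * E * E" for A B E X :: real
        by (simp add: exp_minus)
      have ex: "exp (- s * real (n + 2 - K)) = exp (s * (real K - 2)) * exp (- (\<delta> / 2) * real n) * exp (- (\<delta> / 2) * real n) * exp (- (real n * (h + \<delta>)))"
        using n by (simp add: exp_add[symmetric] of_nat_diff s_def algebra_simps)
      have "real (card (G n)) * exp (- s * real (n + 2 - K))
         \<le> real (Suc n ^ (m * m)) * real m ^ 2 * exp (real n * (h + \<delta>)) * exp (- s * real (n + 2 - K))"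
        by (intro mult_right_mono cardG n) auto
      also have "\<dots> = real (Suc n ^ (m * m)) * M * exp (- (\<delta> / 2) * real n) * exp (- (\<delta> / 2) * real n)"
        unfolding ex M_def using cancel by (simp only: mult.assoc)
      also have "\<dots> \<le> 1 * exp (- (\<delta> / 2) * real n)"
        using n1[OF n(1)] by (intro mult_right_mono) auto
      also have "\<dots> = \<rho> ^ n" by (simp add: \<rho>_def exp_of_nat_mult[symmetric] mult.commute)
      finally show ?thesis .
    qed
    have "bowen_M m ?E s eps N \<le> 0" for N
    proof (rule ennreal_le_epsilon)
      fix e :: real assume e: "0 < e"
      have "(\<lambda>n. \<rho> ^ n / (1 - \<rho>)) \<longlonglongrightarrow> 0"
        using \<rho> by (intro tendsto_divide_zero LIMSEQ_realpow_zero) auto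
      then have "\<forall>\<^sub>F n in sequentially. \<rho> ^ n / (1 - \<rho>) < e \<and> n \<ge> n1 + K + N + 1"
        using e by (intro eventually_conj order_tendstoD(2)[of _ 0] eventually_ge_at_top)
      then obtain N1 where N1: "\<rho> ^ N1 / (1 - \<rho>) < e" "N1 \<ge> n1 + K + N + 1"
        by (auto simp: eventually_sequentially)
      \<comment> \<open>Words are \<open>undefined\<close> beyond their domain, while centres of
        balls have to lie in \<open>Sigma_sh m\<close>; hence the padding by 0.\<close>
      define ext where "ext n a = (\<lambda>t. if t \<le> Suc n then a t else 0)" for n and a :: "nat \<Rightarrow> nat"
      \<comment> \<open>The cover takes all parameters from \<open>N1\<close> on at once, since the
        time at which a point enters some \<open>G n\<close> has no bound uniform over
        \<open>E_Phi\<close>.\<close>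
      define C where "C k = (\<lambda>a. (ext (N1 + k) a, N1 + k + 2 - K)) ` G (N1 + k)" for k
      have "bowen_M m ?E s eps N \<le> (\<integral>\<^sup>+ c. ennreal (exp (- s * real (snd c))) \<partial>count_space (\<Union>k. C k))"
        unfolding bowen_M_def
      proof (intro INF_lower CollectI conjI)
        show "countable (\<Union>k. C k)" using G by (intro countable_UN) (auto simp: C_def countable_finite)
        show "(\<Union>k. C k) \<subseteq> Sigma_sh m \<times> {N..}"
          using N1 assms(1) G(1) words_less by (fastforce simp: C_def ext_def Sigma_sh_def)
        show "?E \<subseteq> (\<Union>(x, n)\<in>(\<Union>k. C k). bowen_ball m n x eps)"
        proof
          fix x assume "x \<in> ?E"
          then have x: "x \<in> Sigma_sh m" "(\<lambda>n. prod_average m phi r (pair_freq n x)) \<longlonglongrightarrow> \<alpha>" by (auto simp: E_Phi_iff)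
          have "\<forall>\<^sub>F n in sequentially. \<bar>prod_average m phi r (pair_freq n x) - \<alpha>\<bar> < \<eta>"
            using tendstoD[OF x(2) \<eta>(1)] by (simp add: dist_real_def)
          then have "\<forall>\<^sub>F n in sequentially. \<bar>prod_average m phi r (pair_freq n x) - \<alpha>\<bar> < \<eta> \<and>
             (pair_freq n x \<in> pair_dists m \<and> imbalance m (pair_freq n x) < \<eta>) \<and> n \<ge> N1"
            by (intro eventually_conj eventually_pair_freq_imbalance x \<eta> eventually_ge_at_top)
          then obtain n where n: "\<bar>prod_average m phi r (pair_freq n x) - \<alpha>\<bar> < \<eta>" "imbalance m (pair_freq n x) < \<eta>" "n \<ge> N1"
            by (auto simp: eventually_sequentially)
          let ?a = "restrict x {..Suc n}"
          have "pair_freq n ?a = pair_freq n x" by (rule pair_freq_cong) auto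
          then have "?a \<in> G n" using n Sigma_shD[OF x(1)] by (auto simp: G_def words_def)
          then have "(ext n ?a, n + 2 - K) \<in> C (n - N1)" using n(3) by (auto simp: C_def)
          then have "(ext n ?a, n + 2 - K) \<in> (\<Union>k. C k)" by (rule UN_I[OF UNIV_I])
          moreover have "x \<in> bowen_ball m (n + 2 - K) (ext n ?a) eps"
            using n(3) N1(2) by (intro bowen_ball_contains[OF assms(1) K x(1)]) (auto simp: ext_def)
          ultimately show "x \<in> (\<Union>(x, n)\<in>(\<Union>k. C k). bowen_ball m n x eps)"
            by (intro UN_I[of "(ext n ?a, n + 2 - K)"]) simp_all
        qed
      qed
      also have "\<dots> \<le> (\<Sum>k. \<integral>\<^sup>+ c. ennreal (exp (- s * real (snd c))) \<partial>count_space (C k))"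
        by (rule nn_integral_count_space_UN_le)
      also have "\<dots> \<le> (\<Sum>k. ennreal (\<rho> ^ (N1 + k)))"
      proof (intro suminf_le)
        fix k
        have fin: "finite (C k)" using G by (simp add: C_def)
        have "(\<integral>\<^sup>+ c. ennreal (exp (- s * real (snd c))) \<partial>count_space (C k)) = (\<Sum>c\<in>C k. ennreal (exp (- s * real (snd c))))"
          by (rule nn_integral_count_space_finite[OF fin])
        also have "\<dots> = (\<Sum>c\<in>C k. ennreal (exp (- s * real (N1 + k + 2 - K))))"
          by (intro sum.cong) (auto simp: C_def)
        also have "\<dots> = ennreal (real (card (C k)) * exp (- s * real (N1 + k + 2 - K)))"
          by (simp add: ennreal_mult ennreal_of_nat_eq_real_of_nat)
        also have "\<dots> \<le> ennreal (\<rho> ^ (N1 + k))"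
        proof (rule ennreal_leI)
          have "card (C k) \<le> card (G (N1 + k))" unfolding C_def by (intro card_image_le G)
          then have "real (card (C k)) * exp (- s * real (N1 + k + 2 - K))
             \<le> real (card (G (N1 + k))) * exp (- s * real (N1 + k + 2 - K))" by (intro mult_right_mono) auto
          also have "\<dots> \<le> \<rho> ^ (N1 + k)" using N1(2) by (intro weight) auto
          finally show "real (card (C k)) * exp (- s * real (N1 + k + 2 - K)) \<le> \<rho> ^ (N1 + k)" .
        qed
        finally show "(\<integral>\<^sup>+ c. ennreal (exp (- s * real (snd c))) \<partial>count_space (C k)) \<le> ennreal (\<rho> ^ (N1 + k))" .
      qed auto
      also have "\<dots> = ennreal (\<rho> ^ N1 / (1 - \<rho>))"
      proof (rule suminf_ennreal_eq)
        show "(\<lambda>k. \<rho> ^ (N1 + k)) sums (\<rho> ^ N1 / (1 - \<rho>))"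
          using sums_mult[OF geometric_sums[of \<rho>], of "\<rho> ^ N1"] \<rho> by (simp add: power_add)
      qed (use \<rho> in auto)
      also have "\<dots> \<le> 0 + ennreal e" using N1(1) by (simp add: ennreal_leI)
      finally show "bowen_M m ?E s eps N \<le> 0 + ennreal e" .
    qed
    then show ?thesis unfolding bowen_m_def s_def by simp
  qed
  show "bowen_h_eps m ?E eps \<le> ereal h"
  proof (rule ereal_le_epsilon2)
    fix e :: real assume "0 < e"
    then have "bowen_m m ?E (h + 2 * (e / 2)) eps = 0" by (intro zero) simp
    then have "bowen_h_eps m ?E eps \<le> ereal (h + 2 * (e / 2))"
      unfolding bowen_h_eps_def by (intro INF_lower) simp
    then show "bowen_h_eps m ?E eps \<le> ereal h + ereal e" by simp
  qed
qed

section \<open>Concatenation of blocks\<close>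

text \<open>Stage \<open>k\<close> is used for so many consecutive blocks that the current block is always short
  compared with the number of blocks before it.\<close>
lemma slow_selection:
  fixes L :: "nat \<Rightarrow> nat"
  obtains \<kappa> :: "nat \<Rightarrow> nat" where "filterlim \<kappa> at_top sequentially"
    "(\<lambda>b. real (L (\<kappa> b)) / real b) \<longlonglongrightarrow> 0"
proof -
  \<comment> \<open>The condition \<open>k * L k \<le> b\<close> makes the ratio at most
    \<open>1 / \<kappa> b\<close>, and \<open>k \<le> b\<close> keeps the set finite.\<close>
  define \<kappa> where "\<kappa> b = Max (insert 0 {k. k \<le> b \<and> k * L k \<le> b})" for b
  have fin: "finite (insert 0 {k. k \<le> b \<and> k * L k \<le> b})" for b by simp
  have \<kappa>: "\<kappa> b * L (\<kappa> b) \<le> b" for b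
  proof -
    have "\<kappa> b \<in> insert 0 {k. k \<le> b \<and> k * L k \<le> b}" unfolding \<kappa>_def by (rule Max_in[OF fin]) simp
    then show ?thesis by auto
  qed
  have lim: "filterlim \<kappa> at_top sequentially"
    unfolding filterlim_at_top
  proof
    fix k
    show "\<forall>\<^sub>F b in sequentially. k \<le> \<kappa> b"
      using eventually_ge_at_top[of "max k (k * L k)"]
    proof eventually_elim
      case (elim b)
      then show ?case unfolding \<kappa>_def by (intro Max_ge[OF fin]) auto
    qed
  qed
  have inv: "(\<lambda>b. 1 / real (\<kappa> b)) \<longlonglongrightarrow> 0"
    using filterlim_compose[OF filterlim_real_sequentially lim]
    by (intro tendsto_divide_0[OF tendsto_const] filterlim_at_top_imp_at_infinity)
  have "\<forall>\<^sub>F b in sequentially. 1 \<le> \<kappa> b" using lim by (simp add: filterlim_at_top)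
  with eventually_ge_at_top[of 1]
  have "\<forall>\<^sub>F b in sequentially. real (L (\<kappa> b)) / real b \<le> 1 / real (\<kappa> b)"
  proof eventually_elim
    case (elim b)
    have "real (\<kappa> b) * real (L (\<kappa> b)) \<le> real b" using \<kappa>[of b] by (metis of_nat_le_iff of_nat_mult)
    then show ?case using elim by (simp add: field_simps)
  qed
  then have "(\<lambda>b. real (L (\<kappa> b)) / real b) \<longlonglongrightarrow> 0"
    by (intro tendsto_sandwich[OF _ _ tendsto_const inv]) auto
  then show ?thesis using lim that by blast
qed

section \<open>Positions and error terms for concatenated blocks\<close>

locale blocks =
  fixes len :: "nat \<Rightarrow> nat"
  assumes len_pos: "1 \<le> len b"
begin

definition start :: "nat \<Rightarrow> nat" where "start b = (\<Sum>c<b. len c)"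

definition block :: "nat \<Rightarrow> nat" where "block u = (LEAST b. u < start (Suc b))"

definition concatenation :: "(nat \<Rightarrow> nat \<Rightarrow> nat) \<Rightarrow> nat \<Rightarrow> nat" where
  "concatenation w u = w (block u) (u - start (block u))"

lemma start_0 [simp]: "start 0 = 0" and start_Suc: "start (Suc b) = start b + len b"
  by (simp_all add: start_def)

lemma start_mono: "b \<le> c \<Longrightarrow> start b \<le> start c"
  unfolding start_def by (intro sum_mono2) auto

lemma le_start: "b \<le> start b"
proof (induction b)
  case (Suc b) then show ?case using len_pos[of b] by (simp add: start_Suc)
qed simp

lemma less_start_block: "u < start (Suc (block u))"
  unfolding block_def
proof (rule LeastI)
  show "u < start (Suc u)" using le_start[of "Suc u"] by simp
qed

lemma start_block_le: "start (block u) \<le> u"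
proof (cases "block u")
  case (Suc b)
  then have "\<not> u < start (Suc b)" using not_less_Least[of b "\<lambda>b. u < start (Suc b)"] by (simp add: block_def)
  then show ?thesis using Suc by simp
qed simp

lemma block_unique: "start b \<le> u \<Longrightarrow> u < start (Suc b) \<Longrightarrow> block u = b"
  using start_mono[of "Suc b" "block u"] start_mono[of "Suc (block u)" b] start_block_le[of u] less_start_block[of u]
  by (cases "block u" b rule: linorder_cases) (force, simp, force)

lemma concatenation_eq: "t < len b \<Longrightarrow> concatenation w (start b + t) = w b t"
  using block_unique[of b "start b + t"] by (simp add: concatenation_def start_Suc)

lemma block_tendsto: "filterlim block at_top sequentially"
  unfolding filterlim_at_top
proof
  fix k
  show "\<forall>\<^sub>F n in sequentially. k \<le> block n"
    using eventually_ge_at_top[of "start k"]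
  proof eventually_elim
    case (elim n)
    show ?case
    proof (rule ccontr)
      assume "\<not> k \<le> block n"
      then have "start (Suc (block n)) \<le> start k" by (intro start_mono) simp
      then show False using less_start_block[of n] elim by simp
    qed
  qed
qed

text \<open>\<open>\<epsilon> b\<close> is an error rate per letter of block \<open>b\<close>; the incomplete last block is charged in full.\<close>
definition err :: "(nat \<Rightarrow> real) \<Rightarrow> nat \<Rightarrow> real" where
  "err \<epsilon> n = (\<Sum>b<block n. real (len b) * \<epsilon> b) + real (len (block n)) + 1"

text \<open>The completed blocks give a weighted Cesaro mean of the null sequence
  \<open>\<epsilon>\<close>. The last block is negligible because at least \<open>block n\<close>
  letters precede it.\<close>

lemma err_tendsto:
  assumes "\<epsilon> \<longlonglongrightarrow> 0" "\<And>b. 0 \<le> \<epsilon> b" "(\<lambda>b. real (len b) / real b) \<longlonglongrightarrow> 0"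
  shows "(\<lambda>n. err \<epsilon> n / real n) \<longlonglongrightarrow> 0"
proof -
  define D where "D b = (\<Sum>c<b. real (len c) * \<epsilon> c)" for b
  have D_lim: "(\<lambda>b. D b / real (start b)) \<longlonglongrightarrow> 0"
  proof (rule LIMSEQ_I)
    fix e :: real assume e: "0 < e"
    obtain b0 where b0: "\<And>b. b \<ge> b0 \<Longrightarrow> \<epsilon> b < e / 2"
      using order_tendstoD(2)[OF assms(1), of "e / 2"] e by (auto simp: eventually_sequentially)
    have le: "D b \<le> D b0 + e / 2 * real (start b)" if "b \<ge> b0" for b
    proof -
      have "D b = D b0 + (\<Sum>c=b0..<b. real (len c) * \<epsilon> c)"
        using that unfolding D_def by (metis atLeast0LessThan le0 sum.atLeastLessThan_concat)
      also have "(\<Sum>c=b0..<b. real (len c) * \<epsilon> c) \<le> (\<Sum>c=b0..<b. real (len c) * (e / 2))"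
        using b0 by (intro sum_mono mult_left_mono) (auto intro: less_imp_le)
      also have "\<dots> \<le> (\<Sum>c<b. real (len c) * (e / 2))"
        using e by (intro sum_mono2) auto
      also have "\<dots> = e / 2 * real (start b)" by (simp add: start_def sum_distrib_left mult.commute)
      finally show ?thesis by simp
    qed
    have "\<forall>\<^sub>F b in sequentially. D b0 / real b < e / 2" using e by real_asymp
    then obtain b1 where b1: "\<And>b. b \<ge> b1 \<Longrightarrow> D b0 / real b < e / 2" by (auto simp: eventually_sequentially)
    show "\<exists>no. \<forall>b\<ge>no. norm (D b / real (start b) - 0) < e"
    proof (intro exI[of _ "max 1 (max b0 b1)"] allI impI)
      fix b assume "max 1 (max b0 b1) \<le> b"
      then have b: "1 \<le> b" "b0 \<le> b" "b1 \<le> b" by auto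
      have s: "real b \<le> real (start b)" "0 < real b" using le_start[of b] b by auto
      have nn: "0 \<le> D b" for b using assms(2) by (simp add: D_def sum_nonneg)
      have "D b / real (start b) \<le> (D b0 + e / 2 * real (start b)) / real (start b)"
        using le[OF b(2)] s by (intro divide_right_mono) auto
      also have "\<dots> = D b0 / real (start b) + e / 2" using s by (simp add: add_divide_distrib)
      also have "D b0 / real (start b) \<le> D b0 / real b" using s nn by (intro divide_left_mono) auto
      also have "D b0 / real b < e / 2" by (rule b1[OF b(3)])
      finally show "norm (D b / real (start b) - 0) < e" using nn[of b] by simp
    qed
  qed
  let ?u = "\<lambda>b. D b / real (start b) + real (len b) / real b"
  have "(\<lambda>n. ?u (block n) + 1 / real n) \<longlonglongrightarrow> 0 + 0 + 0"
    by (intro tendsto_add filterlim_compose[OF D_lim block_tendsto]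
        filterlim_compose[OF assms(3) block_tendsto]) real_asymp
  then have lim: "(\<lambda>n. ?u (block n) + 1 / real n) \<longlonglongrightarrow> 0" by simp
  have nn: "0 \<le> D b" for b using assms(2) by (simp add: D_def sum_nonneg)
  show ?thesis
  proof (rule tendsto_sandwich[OF _ _ tendsto_const lim])
    show "\<forall>\<^sub>F n in sequentially. 0 \<le> err \<epsilon> n / real n"
      using nn by (simp add: err_def D_def)
    have "\<forall>\<^sub>F n in sequentially. block n \<ge> 1"
      using block_tendsto by (simp add: filterlim_at_top)
    then show "\<forall>\<^sub>F n in sequentially. err \<epsilon> n / real n \<le> ?u (block n) + 1 / real n"
      using eventually_ge_at_top[of 1]
    proof eventually_elim
      case (elim n)
      have s: "real (block n) \<le> real (start (block n))" "real (start (block n)) \<le> real n" "0 < real (block n)"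
        using le_start[of "block n"] start_block_le[of n] elim by auto
      have "D (block n) / real n \<le> D (block n) / real (start (block n))"
        using s nn by (intro divide_left_mono) auto
      moreover have "real (len (block n)) / real n \<le> real (len (block n)) / real (block n)"
        using s by (intro divide_left_mono) auto
      ultimately show ?case by (simp add: err_def D_def add_divide_distrib)
    qed
  qed
qed

lemma sum_blocks: "(\<Sum>t<start B. f t) = (\<Sum>b<B. \<Sum>t<len b. f (start b + t))" for f :: "nat \<Rightarrow> real"
proof (induction B)
  case (Suc B)
  have "(\<Sum>t<k + l. f t) = (\<Sum>t<k. f t) + (\<Sum>t<l. f (k + t))" for k l
    by (induction l) auto
  then show ?case using Suc by (simp add: start_Suc)
qed simp

text \<open>Completed blocks are charged at rate \<open>\<epsilon>\<close>, the incomplete one by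
  the trivial bound. The spare 1 later pays for a shift of the summation window.\<close>

lemma abs_sum_le_err:
  fixes f :: "nat \<Rightarrow> real"
  assumes "\<And>t. \<bar>f t\<bar> \<le> 1" "\<And>b. \<bar>\<Sum>t<len b. f (start b + t)\<bar> \<le> real (len b) * \<epsilon> b"
  shows "\<bar>\<Sum>t<n. f t\<bar> + 1 \<le> err \<epsilon> n"
proof -
  let ?B = "block n"
  have sn: "start ?B \<le> n" "n - start ?B \<le> len ?B"
    using start_block_le[of n] less_start_block[of n] by (auto simp: start_Suc)
  have "(\<Sum>t<n. f t) = (\<Sum>t<start ?B. f t) + (\<Sum>t=start ?B..<n. f t)"
    using sn(1) by (metis lessThan_atLeast0 le0 sum.atLeastLessThan_concat)
  moreover have "\<bar>\<Sum>t<start ?B. f t\<bar> \<le> (\<Sum>b<?B. real (len b) * \<epsilon> b)"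
    unfolding sum_blocks by (rule order_trans[OF sum_abs sum_mono]) (rule assms(2))
  moreover have "\<bar>\<Sum>t=start ?B..<n. f t\<bar> \<le> real (len ?B)"
  proof -
    have "\<bar>\<Sum>t=start ?B..<n. f t\<bar> \<le> (\<Sum>t=start ?B..<n. 1)"
      by (rule order_trans[OF sum_abs sum_mono]) (rule assms(1))
    also have "\<dots> = real (n - start ?B)" by simp
    finally show ?thesis using sn(2) by linarith
  qed
  ultimately show ?thesis by (simp add: err_def)
qed

end

text \<open>Countable subadditivity, phrased with the integral over \<open>count_space C\<close> in
  which \<open>bowen_M\<close> measures covers.\<close>

lemma emeasure_UN_countable_le:
  assumes "countable C" "\<And>c. c \<in> C \<Longrightarrow> S c \<in> sets M"
  shows "emeasure M (\<Union>c\<in>C. S c) \<le> (\<integral>\<^sup>+c. emeasure M (S c) \<partial>count_space C)"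
proof -
  have "emeasure M (\<Union>c\<in>C. S c) = (\<integral>\<^sup>+x. indicator (\<Union>c\<in>C. S c) x \<partial>M)"
    using assms by (subst nn_integral_indicator) (auto intro: sets.countable_UN'')
  also have "\<dots> \<le> (\<integral>\<^sup>+x. (\<integral>\<^sup>+c. indicator (S c) x \<partial>count_space C) \<partial>M)"
  proof (rule nn_integral_mono)
    fix x
    show "(indicator (\<Union>c\<in>C. S c) x :: ennreal) \<le> (\<integral>\<^sup>+c. indicator (S c) x \<partial>count_space C)"
    proof (cases "x \<in> (\<Union>c\<in>C. S c)")
      case True
      then obtain c where c: "c \<in> C" "x \<in> S c" by auto
      then have "(indicator (\<Union>c\<in>C. S c) x :: ennreal) = indicator (S c) x"
        by (auto simp: indicator_def)
      also have "\<dots> \<le> (\<integral>\<^sup>+c. indicator (S c) x \<partial>count_space C)"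
        by (rule nn_integral_ge_point[OF c(1)])
      finally show ?thesis .
    qed simp
  qed
  also have "\<dots> = (\<integral>\<^sup>+c. (\<integral>\<^sup>+x. indicator (S c) x \<partial>M) \<partial>count_space C)"
    using assms by (intro nn_integral_count_space_nn_integral) auto
  also have "\<dots> = (\<integral>\<^sup>+c. emeasure M (S c) \<partial>count_space C)"
    using assms by (intro nn_integral_cong) simp
  finally show ?thesis .
qed

section \<open>The lower bound\<close>

lemma l1_dist_ge_component:
  assumes "i < m" "j < m"
  shows "\<bar>q i j - q' i j\<bar> \<le> l1_dist m q q'"
proof -
  have "\<bar>q i j - q' i j\<bar> \<le> (\<Sum>j<m. \<bar>q i j - q' i j\<bar>)"
    using assms by (intro member_le_sum) auto
  also have "\<dots> \<le> l1_dist m q q'" unfolding l1_dist_def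
    using assms by (intro member_le_sum[of i "{..<m}" "\<lambda>i. \<Sum>j<m. \<bar>q i j - q' i j\<bar>"] sum_nonneg) auto
  finally show ?thesis .
qed

lemma pair_count_eq_sum: "real (pair_count n a i j) = (\<Sum>t\<in>{1..n}. if a t = i \<and> a (Suc t) = j then 1 else 0)"
  by (simp add: pair_count_def sum.If_cases Int_def)

text \<open>The mass lives on the space of block sequences and is not pushed forward to
  \<open>Sigma_sh\<close>. A ball of length n fixes all complete blocks before
  \<open>block n\<close>; the fibre of block sequences with those blocks has mass at most
  \<open>exp (- s * n)\<close> for every \<open>s < h\<close> and large n, so no cover can have
  total weight below 1.\<close>

lemma htop_E_Phi_ge:
  assumes "2 \<le> m" and q: "q \<in> pair_dists m" "imbalance m q = 0" "prod_average m phi r q = \<alpha>"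
  shows "ereal (cond_entropy m q) \<le> htop m (E_Phi m phi r \<alpha>)"
proof -
  define h where "h = cond_entropy m q"
  define \<delta> where "\<delta> k = 1 / (real k + 1)" for k
  \<comment> \<open>Taking \<open>nn k\<close> at least \<open>(k + 1) * M\<close> makes
    \<open>nn k * \<delta> k\<close> at least 1 and at least h. This pays for the two letters of
    each word outside the counted positions.\<close>
  define M where "M = max 1 (nat \<lceil>h\<rceil>)"
  have M: "1 \<le> real M" "h \<le> real M" unfolding M_def by linarith+
  have "\<exists>n W. (k + 1) * M \<le> n \<and> W \<subseteq> words m n \<and> (\<forall>a\<in>W. l1_dist m (pair_freq n a) q < \<delta> k) \<and>
      exp (real n * (h - \<delta> k)) \<le> real (card W)" for k
    using many_words_of_type[OF q(1,2), of "\<delta> k" "(k + 1) * M"] assms(1) by (auto simp: \<delta>_def h_def)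
  then obtain nn WW where W: "\<And>k. (k + 1) * M \<le> nn k" "\<And>k. WW k \<subseteq> words m (nn k)"
    "\<And>k a. a \<in> WW k \<Longrightarrow> l1_dist m (pair_freq (nn k) a) q < \<delta> k"
    "\<And>k. exp (real (nn k) * (h - \<delta> k)) \<le> real (card (WW k))"
    by metis
  obtain \<kappa> where \<kappa>: "filterlim \<kappa> at_top sequentially" "(\<lambda>b. real (nn (\<kappa> b) + 2) / real b) \<longlonglongrightarrow> 0"
    using slow_selection[of "\<lambda>k. nn k + 2"] by blast
  define len where "len b = nn (\<kappa> b) + 2" for b
  define V where "V b = WW (\<kappa> b)" for b
  \<comment> \<open>One share of \<open>\<delta>\<close> is the error of the words themselves. Two
    more cover the two uncounted transitions, and likewise the entropy \<open>2 * h\<close> of the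
    two additional letters.\<close>
  define \<epsilon> where "\<epsilon> b = 3 * \<delta> (\<kappa> b)" for b
  interpret blocks len by standard (simp add: len_def)
  have n\<delta>: "1 \<le> real (nn k) * \<delta> k" "h \<le> real (nn k) * \<delta> k" for k
  proof -
    have "real ((k + 1) * M) \<le> real (nn k)" using W(1) of_nat_le_iff by blast
    then have "real M \<le> real (nn k) * \<delta> k" by (simp add: \<delta>_def field_simps)
    then show "1 \<le> real (nn k) * \<delta> k" "h \<le> real (nn k) * \<delta> k" using M by linarith+
  qed
  have \<delta>_pos: "0 < \<delta> k" for k by (simp add: \<delta>_def)
  have \<epsilon>_nonneg: "0 \<le> \<epsilon> b" for b using \<delta>_pos by (simp add: \<epsilon>_def less_imp_le)
  have "(\<lambda>k. 3 * \<delta> k) \<longlonglongrightarrow> 0" unfolding \<delta>_def by real_asymp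
  from filterlim_compose[OF this \<kappa>(1)] have \<epsilon>_lim: "\<epsilon> \<longlonglongrightarrow> 0" by (simp add: \<epsilon>_def[abs_def])
  have err_lim: "(\<lambda>n. err \<epsilon> n / real n) \<longlonglongrightarrow> 0"
    using \<kappa>(2) by (intro err_tendsto \<epsilon>_lim \<epsilon>_nonneg) (simp add: len_def)
  have V: "finite (V b)" "V b \<noteq> {}" "V b \<subseteq> words m (len b - 2)" for b
  proof -
    have "0 < real (card (V b))" unfolding V_def by (rule less_le_trans[OF exp_gt_zero W(4)])
    then show "finite (V b)" "V b \<noteq> {}" by (auto simp: card_gt_0_iff)
    show "V b \<subseteq> words m (len b - 2)" using W(2) by (simp add: V_def len_def)
  qed
  have card_V: "exp (real (len b) * (h - \<epsilon> b)) \<le> real (card (V b))" for b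
  proof -
    have "real (len b) * (h - \<epsilon> b) \<le> real (nn (\<kappa> b)) * (h - \<delta> (\<kappa> b))"
      using n\<delta>(2)[of "\<kappa> b"] \<delta>_pos[of "\<kappa> b"] by (simp add: len_def \<epsilon>_def algebra_simps)
    then show ?thesis using W(4)[of "\<kappa> b"] unfolding V_def by (meson exp_le_cancel_iff order_trans)
  qed
  have conc_mem: "concatenation w \<in> E_Phi m phi r \<alpha>" if w: "\<And>b. w b \<in> V b" for w
  proof -
    let ?x = "concatenation w"
    have w': "w b \<in> words m (nn (\<kappa> b))" for b using w[of b] V(3)[of b] by (auto simp: len_def)
    have x: "?x \<in> Sigma_sh m"
      unfolding Sigma_sh_def
    proof (intro CollectI allI)
      fix u
      have "u - start (block u) < len (block u)"
        using less_start_block[of u] start_block_le[of u] by (simp add: start_Suc)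
      then show "?x u < m" using words_less[OF w'] by (simp add: concatenation_def len_def)
    qed
    have pair_freq_lim: "(\<lambda>n. pair_freq n ?x i j) \<longlonglongrightarrow> q i j" if ij: "i < m" "j < m" for i j
    proof -
      define I where "I t = (if ?x t = i \<and> ?x (Suc t) = j then 1 else (0::real))" for t
      have I: "0 \<le> I t" "I t \<le> 1" for t by (auto simp: I_def)
      have q01: "0 \<le> q i j" "q i j \<le> 1" using pair_distsD(1)[OF q(1)] pair_dists_le_1[OF q(1)] by auto
      have f1: "\<bar>I t - q i j\<bar> \<le> 1" for t using I[of t] q01 by linarith
      have "\<bar>\<Sum>t<len b. I (start b + t) - q i j\<bar> \<le> real (len b) * \<epsilon> b" for b
      proof -
        let ?N = "nn (\<kappa> b)"
        \<comment> \<open>The transition out of position 0 is not part of the type, and the one out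
          of position N + 1 leads into the next block; both get the trivial bound 1.\<close>
        have split: "(\<Sum>t<N + 2. g t) = g 0 + (\<Sum>t\<in>{1..N}. g t) + g (N + 1)" for g :: "nat \<Rightarrow> real" and N
          by (induction N) auto
        have "(\<Sum>t\<in>{1..?N}. I (start b + t)) = real (pair_count ?N (w b) i j)"
          unfolding pair_count_eq_sum
        proof (intro sum.cong refl)
          fix t assume "t \<in> {1..?N}"
          then have "?x (start b + t) = w b t" "?x (start b + Suc t) = w b (Suc t)"
            by (intro concatenation_eq; simp add: len_def)+
          then show "I (start b + t) = (if w b t = i \<and> w b (Suc t) = j then 1 else 0)"
            by (simp add: I_def)
        qed
        then have mid: "(\<Sum>t\<in>{1..?N}. I (start b + t) - q i j) = real ?N * (pair_freq ?N (w b) i j - q i j)"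
          using n\<delta>(1)[of "\<kappa> b"] by (cases "?N = 0") (auto simp: sum_subtractf pair_freq_def algebra_simps)
        have "\<bar>pair_freq ?N (w b) i j - q i j\<bar> \<le> \<delta> (\<kappa> b)"
          using l1_dist_ge_component[OF ij, of "pair_freq ?N (w b)" q] W(3)[of "w b" "\<kappa> b"] w[of b] by (simp add: V_def)
        then have "\<bar>\<Sum>t\<in>{1..?N}. I (start b + t) - q i j\<bar> \<le> real ?N * \<delta> (\<kappa> b)"
          unfolding mid by (simp add: abs_mult mult_left_mono)
        moreover have "(\<Sum>t<len b. I (start b + t) - q i j) = (I (start b) - q i j) +
            (\<Sum>t\<in>{1..?N}. I (start b + t) - q i j) + (I (start b + (?N + 1)) - q i j)"
          unfolding len_def by (subst split) simp
        ultimately have "\<bar>\<Sum>t<len b. I (start b + t) - q i j\<bar> \<le> real ?N * \<delta> (\<kappa> b) + 2"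
          using f1[of "start b"] f1[of "start b + (?N + 1)"] by linarith
        also have "\<dots> \<le> real (len b) * \<epsilon> b"
          using n\<delta>(1)[of "\<kappa> b"] \<delta>_pos[of "\<kappa> b"] by (simp add: len_def \<epsilon>_def algebra_simps)
        finally show ?thesis .
      qed
      from abs_sum_le_err[OF f1 this] have err: "\<bar>\<Sum>t<n. I t - q i j\<bar> + 1 \<le> err \<epsilon> n" for n .
      have bound: "\<bar>pair_freq n ?x i j - q i j\<bar> \<le> err \<epsilon> n / real n" if "n \<ge> 1" for n
      proof -
        have "real (pair_count n ?x i j) = (\<Sum>t\<in>{1..n}. I t)" by (simp add: pair_count_eq_sum I_def)
        \<comment> \<open>Pair counts start at 1 and blocks at 0; the difference
          \<open>I n - I 0\<close> uses up the spare 1 in \<open>err\<close>.\<close>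
        moreover have "(\<Sum>t\<in>{1..n}. I t) = (\<Sum>t<n. I t) - I 0 + I n" by (induction n) auto
        ultimately have "real (pair_count n ?x i j) - real n * q i j = (\<Sum>t<n. I t - q i j) - I 0 + I n"
          by (simp add: sum_subtractf)
        then have "\<bar>real (pair_count n ?x i j) - real n * q i j\<bar> \<le> err \<epsilon> n"
          using err[of n] I[of 0] I[of n] by linarith
        then have "\<bar>real (pair_count n ?x i j) - real n * q i j\<bar> / real n \<le> err \<epsilon> n / real n"
          by (intro divide_right_mono) auto
        moreover have "pair_freq n ?x i j - q i j = (real (pair_count n ?x i j) - real n * q i j) / real n"
          using that by (simp add: pair_freq_def diff_divide_distrib)
        ultimately show ?thesis by (simp add: abs_divide)
      qed
      have "(\<lambda>n. pair_freq n ?x i j - q i j) \<longlonglongrightarrow> 0"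
        by (rule Lim_null_comparison[OF _ err_lim])
           (use eventually_ge_at_top[of 1] in eventually_elim, use bound in simp)
      then show ?thesis by (simp add: LIM_zero_iff)
    qed
    have "(\<lambda>n. prod_average m phi r (pair_freq n ?x)) \<longlonglongrightarrow> prod_average m phi r q"
      unfolding prod_average_def by (intro tendsto_intros pair_freq_lim) auto
    then show ?thesis using x q(3) by (simp add: E_Phi_iff)
  qed
  define Mb where "Mb b = uniform_count_measure (V b)" for b
  have prob: "prob_space (Mb b)" for b
    unfolding Mb_def using V by (intro prob_space_uniform_count_measure)
  interpret product_prob_space Mb UNIV
    by (intro product_prob_spaceI prob)
  let ?\<Omega> = "PiM UNIV Mb"
  have space: "w \<in> space ?\<Omega> \<longleftrightarrow> (\<forall>b. w b \<in> V b)" for w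
    by (auto simp: space_PiM Mb_def space_uniform_count_measure)
  have meas_fibre: "{w \<in> space ?\<Omega>. \<forall>b\<in>{..<B}. w b \<in> {v b}} \<in> sets ?\<Omega>"
    "emeasure ?\<Omega> {w \<in> space ?\<Omega>. \<forall>b\<in>{..<B}. w b \<in> {v b}} = ennreal (\<Prod>b<B. 1 / real (card (V b)))"
    if v: "\<And>b. v b \<in> V b" for v B
  proof -
    have s: "{v b} \<in> sets (Mb b)" for b using v by (simp add: Mb_def sets_uniform_count_measure)
    have e: "emeasure (Mb b) {v b} = ennreal (1 / real (card (V b)))" for b
      using v V by (simp add: Mb_def emeasure_uniform_count_measure)
    have "emeasure ?\<Omega> {w \<in> space ?\<Omega>. \<forall>b\<in>{..<B}. w b \<in> {v b}} = (\<Prod>b<B. emeasure (Mb b) {v b})"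
      using s by (intro emeasure_PiM_Collect) auto
    then show "emeasure ?\<Omega> {w \<in> space ?\<Omega>. \<forall>b\<in>{..<B}. w b \<in> {v b}} = ennreal (\<Prod>b<B. 1 / real (card (V b)))"
      unfolding e by (simp add: prod_ennreal)
    show "{w \<in> space ?\<Omega>. \<forall>b\<in>{..<B}. w b \<in> {v b}} \<in> sets ?\<Omega>"
      by (intro sets.sets_Collect_finite_All sets_Collect_single s) auto
  qed
  have "ereal h \<le> bowen_h_eps m (E_Phi m phi r \<alpha>) 1"
    unfolding bowen_h_eps_def
  proof (rule INF_greatest)
    fix s assume "s \<in> {s. bowen_m m (E_Phi m phi r \<alpha>) s 1 = 0}"
    then have s0: "bowen_m m (E_Phi m phi r \<alpha>) s 1 = 0" by simp
    have "h \<le> s"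
    proof (rule ccontr)
      assume "\<not> h \<le> s"
      \<comment> \<open>With this threshold the gap \<open>(h - s) * n\<close> dominates
        \<open>(\<bar>h\<bar> + 1) * err \<epsilon> n\<close>, hence both the entropy deficit
        \<open>D\<close> of the complete blocks and the loss \<open>\<bar>h\<bar> * len\<close> of
        the unfinished one.\<close>
      then have "0 < (h - s) / (\<bar>h\<bar> + 1)" by (simp add: field_simps)
      from order_tendstoD(2)[OF err_lim this] eventually_ge_at_top[of 1]
      have "\<forall>\<^sub>F n in sequentially. err \<epsilon> n / real n < (h - s) / (\<bar>h\<bar> + 1) \<and> 1 \<le> n"
        by (rule eventually_conj)
      then obtain N where N: "\<And>n. n \<ge> N \<Longrightarrow> err \<epsilon> n / real n < (h - s) / (\<bar>h\<bar> + 1) \<and> 1 \<le> n"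
        by (auto simp: eventually_sequentially)
      have small: "(\<Prod>b<block n. 1 / real (card (V b))) \<le> exp (- s * real n)" if "n \<ge> N" for n
      proof -
        let ?B = "block n"
        define D where "D = (\<Sum>b<?B. real (len b) * \<epsilon> b)"
        have D: "0 \<le> D" using \<epsilon>_nonneg by (simp add: D_def sum_nonneg)
        have e: "err \<epsilon> n = D + real (len ?B) + 1" by (simp add: err_def D_def)
        have "(\<bar>h\<bar> + 1) * err \<epsilon> n \<le> (h - s) * real n"
        proof -
          have "err \<epsilon> n \<le> (h - s) / (\<bar>h\<bar> + 1) * real n"
          proof -
            have n: "0 < real n" using N[OF that] by simp
            have "err \<epsilon> n / real n < (h - s) / (\<bar>h\<bar> + 1)" using N[OF that] by simp
            then show ?thesis unfolding pos_divide_less_eq[OF n] by (rule less_imp_le)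
          qed
          then have "(\<bar>h\<bar> + 1) * err \<epsilon> n \<le> (\<bar>h\<bar> + 1) * ((h - s) / (\<bar>h\<bar> + 1) * real n)"
            by (intro mult_left_mono) auto
          also have "\<dots> = (h - s) * real n" by simp
          finally show ?thesis .
        qed
        moreover have "\<bar>h\<bar> * real (len ?B) + D \<le> (\<bar>h\<bar> + 1) * err \<epsilon> n"
        proof -
          have "\<bar>h\<bar> * real (len ?B) \<le> \<bar>h\<bar> * err \<epsilon> n" using D e by (intro mult_left_mono) auto
          then show ?thesis using D e by (simp add: algebra_simps)
        qed
        moreover have "h * (real n - real (start ?B)) \<le> \<bar>h\<bar> * real (len ?B)"
        proof -
          have "real n - real (start ?B) \<le> real (len ?B)" "0 \<le> real n - real (start ?B)"
            using less_start_block[of n] start_block_le[of n] by (auto simp: start_Suc)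
          then show ?thesis by (intro mult_mono) auto
        qed
        ultimately have "s * real n \<le> h * real (start ?B) - D" by (simp add: algebra_simps)
        moreover have "exp (h * real (start ?B) - D) \<le> (\<Prod>b<?B. real (card (V b)))"
        proof -
          have "h * real (start ?B) - D = (\<Sum>b<?B. real (len b) * (h - \<epsilon> b))"
            by (simp add: start_def D_def sum_distrib_left sum_subtractf algebra_simps)
          then have "exp (h * real (start ?B) - D) = (\<Prod>b<?B. exp (real (len b) * (h - \<epsilon> b)))"
            by (simp add: exp_sum)
          also have "\<dots> \<le> (\<Prod>b<?B. real (card (V b)))"
            using card_V by (intro prod_mono) auto
          finally show ?thesis .
        qed
        ultimately have "exp (s * real n) \<le> (\<Prod>b<?B. real (card (V b)))"
          by (meson exp_le_cancel_iff order_trans)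
        then have "inverse (\<Prod>b<?B. real (card (V b))) \<le> inverse (exp (s * real n))"
          by (intro le_imp_inverse_le) auto
        then show ?thesis by (simp add: exp_minus prod_dividef inverse_eq_divide)
      qed
      have "1 \<le> bowen_M m (E_Phi m phi r \<alpha>) s 1 N"
        unfolding bowen_M_def
      proof (rule INF_greatest)
        fix C assume C: "C \<in> {C. countable C \<and> C \<subseteq> Sigma_sh m \<times> {N..} \<and>
          E_Phi m phi r \<alpha> \<subseteq> (\<Union>(x, n)\<in>C. bowen_ball m n x 1)}"
        define Q where "Q c w \<longleftrightarrow> w \<in> space ?\<Omega> \<and> concatenation w \<in> bowen_ball m (snd c) (fst c) 1" for c w
        \<comment> \<open>All block sequences whose concatenation lies in the ball share their
          complete blocks. Fixing those of one chosen witness gives a measurable superset of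
          explicit mass.\<close>
        define S where "S c = (if \<exists>w. Q c w
          then {w \<in> space ?\<Omega>. \<forall>b\<in>{..<block (snd c)}. w b \<in> {(SOME w. Q c w) b}} else {})" for c
        have S: "S c \<in> sets ?\<Omega> \<and> emeasure ?\<Omega> (S c) \<le> ennreal (exp (- s * real (snd c)))" if "c \<in> C" for c
        proof (cases "\<exists>w. Q c w")
          case True
          then have "Q c (SOME w. Q c w)" by (rule someI_ex)
          then have v: "(SOME w. Q c w) b \<in> V b" for b by (simp add: Q_def space)
          have "snd c \<ge> N" using C that by auto
          then have "ennreal (\<Prod>b<block (snd c). 1 / real (card (V b))) \<le> ennreal (exp (- s * real (snd c)))"
            by (intro ennreal_leI small)
          then show ?thesis using True meas_fibre[OF v] by (simp add: S_def)
        qed (simp add: S_def)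
        have cover: "space ?\<Omega> \<subseteq> (\<Union>c\<in>C. S c)"
        proof
          fix w assume w: "w \<in> space ?\<Omega>"
          then have "concatenation w \<in> E_Phi m phi r \<alpha>" by (intro conc_mem) (simp add: space)
          then obtain c where c: "c \<in> C" "concatenation w \<in> bowen_ball m (snd c) (fst c) 1"
            using C by (force simp: case_prod_beta)
          define v where "v = (SOME w. Q c w)"
          have Qw: "Q c w" using w c by (simp add: Q_def)
          then have Qv: "Q c v" unfolding v_def by (rule someI[where P = "Q c"])
          have agree: "concatenation w u = concatenation v u" if "u < snd c" for u
            using bowen_ball_1D[OF c(2) that] bowen_ball_1D[OF _ that, of "concatenation v" m "fst c"] Qv
            by (simp add: Q_def)
          have "w b = v b" if b: "b < block (snd c)" for b
          proof
            fix t
            have wb: "w b \<in> words m (len b - 2)" "v b \<in> words m (len b - 2)"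
              using Qw Qv V(3)[of b] by (auto simp: Q_def space)
            show "w b t = v b t"
            proof (cases "t < len b")
              case True
              have "start b + t < start (Suc b)" using True by (simp add: start_Suc)
              also have "\<dots> \<le> start (block (snd c))" using b by (intro start_mono) simp
              also have "\<dots> \<le> snd c" by (rule start_block_le)
              finally show ?thesis using agree[of "start b + t"] concatenation_eq[OF True] by simp
            next
              case False
              then have "t \<notin> {..Suc (len b - 2)}" by (simp add: len_def)
              then show ?thesis using wb by (auto simp: words_def PiE_def extensional_def)
            qed
          qed
          then have "w \<in> S c" using w Qw unfolding S_def v_def by auto
          then show "w \<in> (\<Union>c\<in>C. S c)" using c(1) by blast
        qed
        have "1 = emeasure ?\<Omega> (space ?\<Omega>)" by (simp add: emeasure_space_1)
        also have "\<dots> \<le> emeasure ?\<Omega> (\<Union>c\<in>C. S c)"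
          using cover C S by (intro emeasure_mono sets.countable_UN'') auto
        also have "\<dots> \<le> (\<integral>\<^sup>+c. emeasure ?\<Omega> (S c) \<partial>count_space C)"
          using C S by (intro emeasure_UN_countable_le) auto
        also have "\<dots> \<le> (\<integral>\<^sup>+c. ennreal (exp (- s * real (snd c))) \<partial>count_space C)"
          using S by (intro nn_integral_mono) auto
        finally show "1 \<le> (\<integral>\<^sup>+c. ennreal (exp (- s * real (snd c))) \<partial>count_space C)" .
      qed
      also have "\<dots> \<le> bowen_m m (E_Phi m phi r \<alpha>) s 1"
        unfolding bowen_m_def by (rule SUP_upper) simp
      finally show False using s0 by simp
    qed
    then show "ereal h \<le> ereal s" by simp
  qed
  also have "\<dots> \<le> htop m (E_Phi m phi r \<alpha>)"
    unfolding htop_def by (rule SUP_upper) simp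
  finally show ?thesis by (simp add: h_def)
qed

section \<open>Existence of a maximiser and the variational formula\<close>

lemma A_int_eq_prod_average:
  assumes "couple m p P" "0 < m"
  shows "A_int m phi r p P = prod_average m phi r (pair_law m p P)"
  unfolding A_int_eq[OF assms] prod_average_def by (intro prod.cong sum.cong) (auto simp: pair_law_def)

text \<open>Along the frequencies of a point of \<open>E_Phi\<close> the quantity \<open>?d\<close>
  tends to 0. Without an admissible distribution compactness would keep it above a positive
  constant.\<close>

lemma exists_max_entropy:
  assumes "E_Phi m phi r \<alpha> \<noteq> {}"
  obtains q where "q \<in> pair_dists m" "imbalance m q = 0" "prod_average m phi r q = \<alpha>"
    "\<And>q'. q' \<in> pair_dists m \<Longrightarrow> imbalance m q' = 0 \<Longrightarrow> prod_average m phi r q' = \<alpha> \<Longrightarrow> cond_entropy m q' \<le> cond_entropy m q"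
proof -
  let ?d = "\<lambda>q. imbalance m q + \<bar>prod_average m phi r q - \<alpha>\<bar>"
  have cont: "continuous_on (pair_dists m) ?d"
    by (intro continuous_intros continuous_on_imbalance continuous_on_prod_average)
  \<comment> \<open>The zero set of the nonnegative function \<open>?d\<close>, written as a
    superlevel set so that \<open>compact_superlevel\<close> applies.\<close>
  let ?K = "{q \<in> pair_dists m. 0 \<le> - ?d q}"
  have K: "q \<in> ?K \<longleftrightarrow> q \<in> pair_dists m \<and> imbalance m q = 0 \<and> prod_average m phi r q = \<alpha>" for q
    using imbalance_nonneg[of m q] by fastforce
  have "?K \<noteq> {}"
  proof
    assume "?K = {}"
    then have "0 < ?d q" if "q \<in> pair_dists m" for q
      using that by (metis (mono_tags, lifting) empty_iff mem_Collect_eq neg_0_le_iff_le not_le)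
    then obtain c where c: "c > 0" "\<And>q. q \<in> pair_dists m \<Longrightarrow> c \<le> ?d q"
      using compact_pos_lower_bound[OF compact_pair_dists cont] by blast
    obtain x where x: "x \<in> Sigma_sh m" "(\<lambda>n. prod_average m phi r (pair_freq n x)) \<longlonglongrightarrow> \<alpha>"
      using assms by (auto simp: E_Phi_iff)
    have "\<forall>\<^sub>F n in sequentially. \<bar>prod_average m phi r (pair_freq n x) - \<alpha>\<bar> < c / 2"
      using tendstoD[OF x(2), of "c / 2"] c(1) by (simp add: dist_real_def)
    moreover have "\<forall>\<^sub>F n in sequentially. pair_freq n x \<in> pair_dists m \<and> imbalance m (pair_freq n x) < c / 2"
      using c(1) by (intro eventually_pair_freq_imbalance x) simp
    ultimately have "\<forall>\<^sub>F n in sequentially. False"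
    proof eventually_elim
      case (elim n)
      then show ?case using c(2)[of "pair_freq n x"] by linarith
    qed
    then show False by simp
  qed
  moreover have "compact ?K" by (intro compact_superlevel continuous_on_minus cont)
  moreover have "continuous_on ?K (cond_entropy m)" by (rule continuous_on_subset[OF continuous_on_cond_entropy]) auto
  ultimately obtain q where q: "q \<in> ?K" "\<And>q'. q' \<in> ?K \<Longrightarrow> cond_entropy m q' \<le> cond_entropy m q"
    using continuous_attains_sup[of ?K "cond_entropy m"] by blast
  then show thesis using that[of q] unfolding K by blast
qed

theorem theorem5p4:
  fixes m r :: nat and phi :: "nat \<Rightarrow> nat \<Rightarrow> nat \<Rightarrow> real"
  assumes "m \<ge> 2" and "r \<ge> 1"
  shows "(\<forall>p P. couple m p P \<longrightarrow>
            A_int m phi r p P = (\<Prod>k<r. \<Sum>i<m. \<Sum>j<m. phi k i j * p i * P i j)) \<and>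
         (\<forall>alpha. E_Phi m phi r alpha \<noteq> {} \<longrightarrow>
            (\<exists>p P. couple m p P \<and> A_int m phi r p P = alpha \<and>
                   htop m (E_Phi m phi r alpha) = ereal (H2 m p P)) \<and>
            (\<forall>p P. couple m p P \<and> A_int m phi r p P = alpha \<longrightarrow>
                   ereal (H2 m p P) \<le> htop m (E_Phi m phi r alpha)))"
proof (intro conjI allI impI)
  have m: "0 < m" using assms(1) by simp
  show "A_int m phi r p P = (\<Prod>k<r. \<Sum>i<m. \<Sum>j<m. phi k i j * p i * P i j)"
    if "couple m p P" for p P
    by (rule A_int_eq[OF that m])
  have lower: "ereal (H2 m p P) \<le> htop m (E_Phi m phi r alpha)"
    if "couple m p P" "A_int m phi r p P = alpha" for p P alpha
    unfolding H2_eq_cond_entropy[OF that(1)] using that A_int_eq_prod_average[OF that(1) m]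
    by (intro htop_E_Phi_ge assms(1) pair_law_in_pair_dists imbalance_pair_law) auto
  then show "ereal (H2 m p P) \<le> htop m (E_Phi m phi r alpha)"
    if "couple m p P \<and> A_int m phi r p P = alpha" for p P alpha
    using that by blast
  fix alpha assume "E_Phi m phi r alpha \<noteq> {}"
  then obtain q where q: "q \<in> pair_dists m" "imbalance m q = 0" "prod_average m phi r q = alpha"
    "\<And>q'. q' \<in> pair_dists m \<Longrightarrow> imbalance m q' = 0 \<Longrightarrow> prod_average m phi r q' = alpha \<Longrightarrow> cond_entropy m q' \<le> cond_entropy m q"
    using exists_max_entropy by blast
  let ?p = "row_sum m q" and ?P = "cond_prob m q"
  have cp: "couple m ?p ?P" by (rule couple_of_balanced[OF q(1,2)])
  \<comment> \<open>The uniform rows of states of mass zero disappear again here, so the couple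
    inherits constraint and entropy from \<open>q\<close>.\<close>
  have pair_law: "pair_law m ?p ?P = q"
    using pair_distsD(2)[OF q(1)] by (auto simp: pair_law_def row_sum_mult_cond_prob[OF q(1)] fun_eq_iff)
  have A: "A_int m phi r ?p ?P = alpha" using A_int_eq_prod_average[OF cp m] q(3) by (simp add: pair_law)
  have "htop m (E_Phi m phi r alpha) \<le> ereal (H2 m ?p ?P)"
    unfolding H2_eq_cond_entropy[OF cp] pair_law using htop_E_Phi_le[OF assms(1) q(4)] by blast
  with lower[OF cp A] have "htop m (E_Phi m phi r alpha) = ereal (H2 m ?p ?P)" by (rule antisym[rotated])
  with cp A show "\<exists>p P. couple m p P \<and> A_int m phi r p P = alpha \<and>
      htop m (E_Phi m phi r alpha) = ereal (H2 m p P)" by blast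
qed

end
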